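(* Let $\psi$ be a fast majorant, and let $\Omega_{1}$ be a bounded domain of $\mathbb{C}^{n}$. Let $u$ and $v$ be real-valued pluriharmonic functions in $\Omega_{1}$ with $f=u+iv$ holomorphic on $\Omega_1$. Then the following statements are equivalent. ($\mathscr{D}_{1}$) $u\in\mathscr{L}_{\psi,\mathrm{int}}(\Omega_{1})$; ($\mathscr{D}_{2}$) there is a positive constant $C$ such that $|\nabla u(z)|\leq C\,\dfrac{\psi(d_{\Omega_{1}}(z))}{d_{\Omega_{1}}(z)}$ for all $z\in\Omega_{1}$; ($\mathscr{D}_{3}$) $|u|\in\mathscr{L}_{\psi,\mathrm{int}}(\Omega_{1})$; ($\mathscr{D}_{4}$) for a given $p$, where $p\geq\frac{2n-2}{2n-1}$ if $n\geq2$ and $p>0$ if $n=1$, there is a positive constant $C$ such that $I_{u,p}(z)\leq C\,\dfrac{\psi(d_{\Omega_{1}}(z))}{d_{\Omega_{1}}(z)}$ for all $z\in\Omega_{1}$; ($\mathscr{D}_{5}$) $v\in\mathscr{L}_{\psi,\mathrm{int}}(\Omega_{1})$; ($\mathscr{D}_{6}$) there is a positive constant $C$ such that $|\nabla v(z)|\leq C\,\dfrac{\psi(d_{\Omega_{1}}(z))}{d_{\Omega_{1}}(z)}$ for all $z\in\Omega_{1}$; ($\mathscr{D}_{7}$) $|v|\in\mathscr{L}_{\psi,\mathrm{int}}(\Omega_{1})$; ($\mathscr{D}_{8}$) for a given $p$, where $p\geq\frac{2n-2}{2n-1}$ if $n\geq2$ and $p>0$ if $n=1$, there is a positive constant $C$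 such that $I_{v,p}(z)\leq C\,\dfrac{\psi(d_{\Omega_{1}}(z))}{d_{\Omega_{1}}(z)}$ for all $z\in\Omega_{1}$; ($\mathscr{D}_{9}$) $f\in\mathscr{L}_{\psi,\mathrm{int}}(\Omega_{1})$; ($\mathscr{D}_{10}$) $|f|\in\mathscr{L}_{\psi,\mathrm{int}}(\Omega_{1})$.
   Context: A twice continuously differentiable function is pluriharmonic if $\partial^2/\partial z_j\partial\overline{z}_k$ of it vanishes for all $j,k$. Majorants: a continuous increasing function $\psi:[0,\infty)\to[0,\infty)$ with $\psi(0)=0$ is a majorant if $\psi(t)/t$ is non-increasing for $t>0$. A majorant $\psi$ is fast if there are $\delta_0>0$ and $C>0$ such that $\int_0^\delta\frac{\psi(t)}{t}dt\leq C\psi(\delta)$ for all $0<\delta<\delta_0$. Internal Lipschitz spaces: let $d_{\Omega_1}(z)$ be the Euclidean distance from $z$ to $\partial\Omega_1$. For $z_1,z_2\in\Omega_1$, $$d_{\psi,\Omega_1}(z_1,z_2)=\inf\int_\gamma\frac{\psi(d_{\Omega_1}(z))}{d_{\Omega_1}(z)}\,ds(z),$$ where $ds$ is arc length and the infimum is over all rectifiable curves $\gamma\subset\Omega_1$ joining $z_1$ to $z_2$. A function $F$ from $\Omega_1$ into $\mathbb{C}$ or $\mathbb{R}$ belongs to $\mathscr{L}_{\psi,\mathrm{int}}(\Omega_1)$ if there is a constant $C=C(F)>0$ such that $|F(z_1)-F(z_2)|\leq C\,d_{\psi,\Omega_1}(z_1,z_2)$ for all $z_1,z_2\in\Omega_1$.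 Gradient: with $z=(x_1+iy_1,\ldots,x_n+iy_n)$, $\nabla u=(u_{x_1},u_{y_1},\ldots,u_{x_n},u_{y_n})$. Means: with $\mathbb{B}^n(z,r)$ the open Euclidean ball, $|\cdot|$ of a set its Lebesgue measure and $d\mu$ Lebesgue measure, $$I_{u,p}(z)=\left(\frac{1}{|\mathbb{B}^n(z,d_{\Omega_1}(z)/2)|}\int_{\mathbb{B}^n(z,d_{\Omega_1}(z)/2)}|\nabla u(w)|^p\,d\mu(w)\right)^{1/p},$$ and $I_{v,p}$ is defined in the same way with $v$ in place of $u$. *)

theory Defs
  imports "HOL-Analysis.Analysis"
begin

text \<open>The space of n complex variables is \<open>complex ^ 'n\<close>, with n = \<open>CARD('n)\<close>; its norm is the
  Euclidean norm.  The coordinates are \<open>z $ j = x\<^sub>j + \<i> y\<^sub>j\<close>.\<close>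

definition partial_x :: "'n::finite \<Rightarrow> (complex ^ 'n \<Rightarrow> 'b::real_normed_vector) \<Rightarrow> complex ^ 'n \<Rightarrow> 'b"
  where "partial_x j F z = vector_derivative (\<lambda>t::real. F (z + t *\<^sub>R axis j 1)) (at 0)"

definition partial_y :: "'n::finite \<Rightarrow> (complex ^ 'n \<Rightarrow> 'b::real_normed_vector) \<Rightarrow> complex ^ 'n \<Rightarrow> 'b"
  where "partial_y j F z = vector_derivative (\<lambda>t::real. F (z + t *\<^sub>R axis j \<i>)) (at 0)"

definition d_dz :: "'n::finite \<Rightarrow> (complex ^ 'n \<Rightarrow> complex) \<Rightarrow> complex ^ 'n \<Rightarrow> complex"
  where "d_dz j F z = (partial_x j F z - \<i> * partial_y j F z) / 2"

definition d_dzbar :: "'n::finite \<Rightarrow> (complex ^ 'n \<Rightarrow> complex) \<Rightarrow> complex ^ 'n \<Rightarrow> complex"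
  where "d_dzbar j F z = (partial_x j F z + \<i> * partial_y j F z) / 2"

text \<open>The following is meant for open sets \<open>S\<close> only.\<close>

definition twice_continuously_differentiable_on ::
    "('a::real_normed_vector \<Rightarrow> 'b::real_normed_vector) \<Rightarrow> 'a set \<Rightarrow> bool"
  where "twice_continuously_differentiable_on F S \<longleftrightarrow>
    (\<exists>(F' :: 'a \<Rightarrow> 'a \<Rightarrow>\<^sub>L 'b) (F'' :: 'a \<Rightarrow> 'a \<Rightarrow>\<^sub>L ('a \<Rightarrow>\<^sub>L 'b)).
      (\<forall>x\<in>S. (F has_derivative blinfun_apply (F' x)) (at x)) \<and>
      (\<forall>x\<in>S. (F' has_derivative blinfun_apply (F'' x)) (at x)) \<and>
      continuous_on S F'')"

definition pluriharmonic_on :: "(complex ^ 'n \<Rightarrow> real) \<Rightarrow> (complex ^ 'n::finite) set \<Rightarrow> bool"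
  where "pluriharmonic_on u S \<longleftrightarrow>
    twice_continuously_differentiable_on u S \<and>
    (\<forall>z\<in>S. \<forall>j k. d_dz j (d_dzbar k (\<lambda>w. complex_of_real (u w))) z = 0)"

text \<open>Holomorphy in several variables (on an open set): the real Frechet derivative exists and is
  complex linear.\<close>

definition several_holomorphic_on :: "(complex ^ 'n \<Rightarrow> complex) \<Rightarrow> (complex ^ 'n::finite) set \<Rightarrow> bool"
  where "several_holomorphic_on f S \<longleftrightarrow>
    (\<forall>z\<in>S. \<exists>f'. (f has_derivative f') (at z) \<and> (\<forall>c h. f' (c *s h) = c * f' h))"

text \<open>The gradient is a vector of n pairs \<open>(u\<^bsub>x\<^sub>j\<^esub>, u\<^bsub>y\<^sub>j\<^esub>)\<close>; its norm is the Euclidean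
  norm on the real space of dimension 2n.\<close>

definition gradient :: "(complex ^ 'n \<Rightarrow> real) \<Rightarrow> complex ^ 'n::finite \<Rightarrow> (real \<times> real) ^ 'n"
  where "gradient u z = (\<chi> j. (partial_x j u z, partial_y j u z))"

text \<open>Only the values on \<open>{0..}\<close> matter; ``increasing'' is read as nondecreasing.\<close>

definition majorant :: "(real \<Rightarrow> real) \<Rightarrow> bool"
  where "majorant \<psi> \<longleftrightarrow>
    continuous_on {0..} \<psi> \<and> mono_on {0..} \<psi> \<and> (\<forall>t\<ge>0. 0 \<le> \<psi> t) \<and> \<psi> 0 = 0 \<and>
    antimono_on {0<..} (\<lambda>t. \<psi> t / t)"

text \<open>Integrability is required explicitly, since \<open>integral\<close> is 0 for a divergent integral.\<close>

definition fast_majorant :: "(real \<Rightarrow> real) \<Rightarrow> bool"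
  where "fast_majorant \<psi> \<longleftrightarrow> majorant \<psi> \<and>
    (\<exists>\<delta>0>0. \<exists>C>0. \<forall>\<delta>. 0 < \<delta> \<and> \<delta> < \<delta>0 \<longrightarrow>
      (\<lambda>t. \<psi> t / t) integrable_on {0..\<delta>} \<and>
      integral {0..\<delta>} (\<lambda>t. \<psi> t / t) \<le> C * \<psi> \<delta>)"

definition polygonal_lengths :: "(real \<Rightarrow> 'a::metric_space) \<Rightarrow> real \<Rightarrow> real \<Rightarrow> real set"
  where "polygonal_lengths g a b =
    {(\<Sum>i<k. dist (g (t i)) (g (t (Suc i)))) | (t :: nat \<Rightarrow> real) k.
       t 0 = a \<and> t k = b \<and> (\<forall>i<k. t i \<le> t (Suc i))}"

definition rectifiable_path :: "(real \<Rightarrow> 'a::metric_space) \<Rightarrow> bool"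
  where "rectifiable_path g \<longleftrightarrow> path g \<and> bdd_above (polygonal_lengths g 0 1)"

text \<open>The length of \<open>g\<close> on \<open>{0..t}\<close>, extended to all of the reals by constants outside \<open>{0..1}\<close>.\<close>

definition arc_length :: "(real \<Rightarrow> 'a::metric_space) \<Rightarrow> real \<Rightarrow> real"
  where "arc_length g t = Sup (polygonal_lengths g 0 (max 0 (min t 1)))"

text \<open>The integral with respect to \<open>ds\<close> is the Lebesgue-Stieltjes integral over the parameter
  interval, with the arc length as integrator.\<close>

definition arc_length_integral :: "(real \<Rightarrow> 'a::metric_space) \<Rightarrow> ('a \<Rightarrow> real) \<Rightarrow> real"
  where "arc_length_integral g \<phi> =
    set_lebesgue_integral (interval_measure (arc_length g)) {0..1} (\<lambda>t. \<phi> (g t))"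

definition bdist :: "'a::metric_space set \<Rightarrow> 'a \<Rightarrow> real"
  where "bdist \<Omega> z = infdist z (frontier \<Omega>)"

definition internal_dist ::
    "(real \<Rightarrow> real) \<Rightarrow> 'a::metric_space set \<Rightarrow> 'a \<Rightarrow> 'a \<Rightarrow> real"
  where "internal_dist \<psi> \<Omega> z1 z2 =
    Inf {arc_length_integral g (\<lambda>z. \<psi> (bdist \<Omega> z) / bdist \<Omega> z) | g.
      rectifiable_path g \<and> path_image g \<subseteq> \<Omega> \<and> pathstart g = z1 \<and> pathfinish g = z2}"

definition internal_Lipschitz ::
    "(real \<Rightarrow> real) \<Rightarrow> 'a::metric_space set \<Rightarrow> ('a \<Rightarrow> 'b::real_normed_vector) set"
  where "internal_Lipschitz \<psi> \<Omega> =
    {F. \<exists>C>0. \<forall>z1\<in>\<Omega>. \<forall>z2\<in>\<Omega>. norm (F z1 - F z2) \<le> C * internal_dist \<psi> \<Omega> z1 z2}"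

definition gradient_mean ::
    "(complex ^ 'n) set \<Rightarrow> (complex ^ 'n \<Rightarrow> real) \<Rightarrow> real \<Rightarrow> complex ^ 'n::finite \<Rightarrow> real"
  where "gradient_mean \<Omega> u p z =
    (1 / measure lebesgue (ball z (bdist \<Omega> z / 2)) *
      set_lebesgue_integral lebesgue (ball z (bdist \<Omega> z / 2)) (\<lambda>w. norm (gradient u w) powr p))
    powr (1 / p)"

definition all_equivalent :: "bool list \<Rightarrow> bool"
  where "all_equivalent Ps \<longleftrightarrow> (\<forall>P\<in>set Ps. \<forall>Q\<in>set Ps. P \<longleftrightarrow> Q)"

end

theory Submission
  imports Defs "HOL-Complex_Analysis.Cauchy_Integral_Formula"
begin

text \<open>Since \<open>f\<close> is holomorphic, the Cauchy-Riemann equations give \<open>|\<nabla>u| = |\<nabla>v|\<close>, so it is enough to see that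
  each of the conditions is equivalent to the growth condition \<open>|\<nabla>u| \<le> C \<psi>(d)/d\<close>, where \<open>d\<close> is the
  distance to the boundary.

  The growth condition bounds the increment of \<open>u\<close> along a rectifiable curve by the integral of
  \<open>\<psi>(d)/d\<close>, hence implies the Lipschitz condition for \<open>u\<close>, and likewise for \<open>v\<close>; the ones for \<open>f\<close>, \<open>|u|\<close>, \<open>|v|\<close>
  and \<open>|f|\<close> follow at once (\<open>derivative_bound_imp_internal_Lipschitz\<close>).

  Conversely, on the ball of radius \<open>d(z)/2\<close> about \<open>z\<close> the weight \<open>\<psi>(d)/d\<close> is at most twice its value
  at \<open>z\<close>, as \<open>\<psi>(t)/t\<close> is non-increasing. Integrating along segments, an internal Lipschitz condition becomes
  an ordinary one on this ball, with constant \<open>C \<psi>(d(z))/d(z)\<close>, and so bounds derivatives at \<open>z\<close>.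
  This works for absolute values as well (\<open>norm_local_Lipschitz_derivative\<close>): at a zero of a function,
  the function and its absolute value have increments of the same size, and away from the zeros \<open>|u|\<close> is
  locally \<open>u\<close> or \<open>-u\<close>, while the derivative of \<open>|f|\<close> in a suitable complex multiple of the direction \<open>h\<close>
  has size \<open>|f' h|\<close>.

  That the growth condition controls the means is clear from the same comparison of weights. For the
  converse, \<open>|\<nabla>u|\<close> satisfies the mean value inequality on the circles cut out by complex lines: differentiate
  Cauchy's formula for \<open>f\<close> in the direction of the gradient (\<open>gradient_circle_submean\<close>). As Lebesgue measure
  is invariant under isometries, averaging over the circles gives the inequality on balls
  (\<open>circle_submean_imp_ball_submean\<close>). Finally a continuous non-negative function that satisfies the mean value
  inequality satisfies it for each of its powers with positive exponent, up to a constant factor (\<open>submean_power\<close>),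
  so \<open>|\<nabla>u|\<close> at the centre is bounded by a multiple of its \<open>L\<^sup>p\<close> mean.\<close>

section \<open>Arc length\<close>

lemma dist_in_polygonal_lengths: "a \<le> b \<Longrightarrow> dist (g a) (g b) \<in> polygonal_lengths g a b"
  unfolding polygonal_lengths_def
  by (intro CollectI exI[of _ "\<lambda>i. if i = 0 then a else b"] exI[of _ 1]) auto

lemma polygonal_lengths_concat:
  assumes "x \<in> polygonal_lengths g a b" "y \<in> polygonal_lengths g b c"
  shows "x + y \<in> polygonal_lengths g a c"
proof -
  obtain s k where s: "s 0 = a" "s k = b" "\<forall>i<k. s i \<le> s (Suc i)"
    and x: "x = (\<Sum>i<k. dist (g (s i)) (g (s (Suc i))))"
    using assms(1) unfolding polygonal_lengths_def by blast
  obtain t m where t: "t 0 = b" "t m = c" "\<forall>i<m. t i \<le> t (Suc i)"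
    and y: "y = (\<Sum>i<m. dist (g (t i)) (g (t (Suc i))))"
    using assms(2) unfolding polygonal_lengths_def by blast
  define r where "r i = (if i \<le> k then s i else t (i - k))" for i
  have r_t: "r (k + i) = t i" for i
    using s t by (auto simp: r_def)
  have "(\<Sum>i<k + m. dist (g (r i)) (g (r (Suc i))))
      = (\<Sum>i<k. dist (g (r i)) (g (r (Suc i)))) + (\<Sum>i<m. dist (g (r (k + i))) (g (r (Suc (k + i)))))"
    by (induction m) (simp_all add: ac_simps)
  also have "(\<Sum>i<k. dist (g (r i)) (g (r (Suc i)))) = x"
    unfolding x by (intro sum.cong) (auto simp: r_def)
  also have "(\<Sum>i<m. dist (g (r (k + i))) (g (r (Suc (k + i))))) = y"
    unfolding y by (intro sum.cong) (simp_all add: r_t flip: add_Suc_right)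
  finally have "x + y = (\<Sum>i<k + m. dist (g (r i)) (g (r (Suc i))))" ..
  moreover have "r i \<le> r (Suc i)" if "i < k + m" for i
  proof (cases "i < k")
    case True
    then show ?thesis using s by (simp add: r_def)
  next
    case False
    then obtain j where "i = k + j" using le_Suc_ex by (metis not_less)
    moreover from this have "t j \<le> t (Suc j)" using that t(3) by simp
    ultimately show ?thesis using r_t[of j] r_t[of "Suc j"] by (simp only: add_Suc_right)
  qed
  moreover have "r 0 = a" "r (k + m) = c"
    using s t r_t[of m] by (simp_all add: r_def)
  ultimately show ?thesis unfolding polygonal_lengths_def by blast
qed

text \<open>Clipping the vertices of an inscribed polygon at \<open>b\<close> from above and from below splits it into
  two; only the edge across \<open>b\<close> is replaced by two edges, and it does not get shorter.\<close>

lemma polygonal_lengths_split: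
  assumes "x \<in> polygonal_lengths g a c" "a \<le> b" "b \<le> c"
  obtains y z where "y \<in> polygonal_lengths g a b" "z \<in> polygonal_lengths g b c" "x \<le> y + z"
proof -
  obtain t k where t: "t 0 = a" "t k = c" "\<forall>i<k. t i \<le> t (Suc i)"
    and x: "x = (\<Sum>i<k. dist (g (t i)) (g (t (Suc i))))"
    using assms(1) unfolding polygonal_lengths_def by blast
  define y where "y = (\<Sum>i<k. dist (g (min (t i) b)) (g (min (t (Suc i)) b)))"
  define z where "z = (\<Sum>i<k. dist (g (max (t i) b)) (g (max (t (Suc i)) b)))"
  have "x \<le> y + z"
    unfolding x y_def z_def sum.distrib[symmetric]
  proof (rule sum_mono)
    fix i assume "i \<in> {..<k}"
    then have "t i \<le> t (Suc i)" using t by auto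
    then show "dist (g (t i)) (g (t (Suc i)))
      \<le> dist (g (min (t i) b)) (g (min (t (Suc i)) b)) + dist (g (max (t i) b)) (g (max (t (Suc i)) b))"
      using dist_triangle[of "g (t i)" "g (t (Suc i))" "g b"]
      by (cases "t i \<le> b"; cases "t (Suc i) \<le> b") (auto simp: min_def max_def)
  qed
  moreover have "y \<in> polygonal_lengths g a b"
    unfolding polygonal_lengths_def y_def using t assms
    by (intro CollectI exI[of _ "\<lambda>i. min (t i) b"] exI[of _ k]) (auto intro: min.mono)
  moreover have "z \<in> polygonal_lengths g b c"
    unfolding polygonal_lengths_def z_def using t assms
    by (intro CollectI exI[of _ "\<lambda>i. max (t i) b"] exI[of _ k]) (auto intro: max.mono)
  ultimately show thesis using that by blast
qed

lemma monotone_vertices: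
  fixes t :: "nat \<Rightarrow> 'a::preorder"
  assumes "i \<le> j" "j \<le> k" "\<forall>i<k. t i \<le> t (Suc i)"
  shows "t i \<le> t j"
  using assms(1,2)
proof (induction j rule: dec_induct)
  case (step n)
  then have "t i \<le> t n" "t n \<le> t (Suc n)" using assms(3) by simp_all
  then show ?case by (rule order_trans)
qed simp

lemma bdd_above_polygonal_lengths_subinterval:
  assumes "rectifiable_path g" "0 \<le> a" "a \<le> b" "b \<le> 1"
  shows "bdd_above (polygonal_lengths g a b)"
proof -
  obtain M where M: "\<And>x. x \<in> polygonal_lengths g 0 1 \<Longrightarrow> x \<le> M"
    using assms(1) unfolding rectifiable_path_def bdd_above_def by blast
  have "x \<le> M" if "x \<in> polygonal_lengths g a b" for x
  proof -
    have "dist (g 0) (g a) + x + dist (g b) (g 1) \<in> polygonal_lengths g 0 1"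
      by (intro polygonal_lengths_concat[OF polygonal_lengths_concat[OF dist_in_polygonal_lengths that]
            dist_in_polygonal_lengths] assms)
    from M[OF this] show ?thesis
      using zero_le_dist[of "g 0" "g a"] zero_le_dist[of "g b" "g 1"] by linarith
  qed
  then show ?thesis by (rule bdd_aboveI)
qed

lemma Sup_polygonal_lengths_add:
  assumes "rectifiable_path g" "0 \<le> a" "a \<le> b" "b \<le> c" "c \<le> 1"
  shows "Sup (polygonal_lengths g a c) = Sup (polygonal_lengths g a b) + Sup (polygonal_lengths g b c)"
proof -
  have bdd: "bdd_above (polygonal_lengths g a b)" "bdd_above (polygonal_lengths g b c)"
    "bdd_above (polygonal_lengths g a c)"
    using assms by (auto intro!: bdd_above_polygonal_lengths_subinterval)
  have ne: "polygonal_lengths g a b \<noteq> {}" "polygonal_lengths g b c \<noteq> {}" "polygonal_lengths g a c \<noteq> {}"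
    using dist_in_polygonal_lengths[of a b g] dist_in_polygonal_lengths[of b c g]
      dist_in_polygonal_lengths[of a c g] assms by auto
  show ?thesis
  proof (rule antisym)
    show "Sup (polygonal_lengths g a c) \<le> Sup (polygonal_lengths g a b) + Sup (polygonal_lengths g b c)"
    proof (rule cSup_least[OF ne(3)])
      fix x assume "x \<in> polygonal_lengths g a c"
      then obtain y z where "y \<in> polygonal_lengths g a b" "z \<in> polygonal_lengths g b c" "x \<le> y + z"
        using polygonal_lengths_split assms by metis
      then show "x \<le> Sup (polygonal_lengths g a b) + Sup (polygonal_lengths g b c)"
        using cSup_upper[OF _ bdd(1)] cSup_upper[OF _ bdd(2)] by fastforce
    qed
    have "y + z \<le> Sup (polygonal_lengths g a c)"
      if "y \<in> polygonal_lengths g a b" "z \<in> polygonal_lengths g b c" for y z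
      using cSup_upper[OF polygonal_lengths_concat[OF that] bdd(3)] .
    then have "z \<le> Sup (polygonal_lengths g a c) - Sup (polygonal_lengths g a b)"
      if "z \<in> polygonal_lengths g b c" for z
      using cSup_least[OF ne(1), of "Sup (polygonal_lengths g a c) - z"] that by fastforce
    then show "Sup (polygonal_lengths g a b) + Sup (polygonal_lengths g b c) \<le> Sup (polygonal_lengths g a c)"
      using cSup_least[OF ne(2)] by fastforce
  qed
qed

lemma arc_length_diff:
  assumes "rectifiable_path g" "0 \<le> a" "a \<le> b" "b \<le> 1"
  shows "arc_length g b - arc_length g a = Sup (polygonal_lengths g a b)"
  using Sup_polygonal_lengths_add[of g 0 a b] assms by (simp add: arc_length_def)

lemma dist_le_arc_length_diff:
  assumes "rectifiable_path g" "0 \<le> a" "a \<le> b" "b \<le> 1"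
  shows "dist (g a) (g b) \<le> arc_length g b - arc_length g a"
  using assms arc_length_diff[OF assms]
  by (auto intro!: cSup_upper dist_in_polygonal_lengths bdd_above_polygonal_lengths_subinterval)

lemma arc_length_mono:
  assumes "rectifiable_path g" "x \<le> y"
  shows "arc_length g x \<le> arc_length g y"
proof -
  have "dist (g (max 0 (min x 1))) (g (max 0 (min y 1)))
      \<le> arc_length g (max 0 (min y 1)) - arc_length g (max 0 (min x 1))"
    using assms by (intro dist_le_arc_length_diff) auto
  then have "arc_length g (max 0 (min x 1)) \<le> arc_length g (max 0 (min y 1))"
    using order_trans[OF zero_le_dist] diff_ge_0_iff_ge by blast
  then show ?thesis by (simp add: arc_length_def)
qed

text \<open>An inscribed polygon of almost maximal length keeps almost its length when its initial part is
  moved slightly along the curve; so an initial piece of the curve is short.\<close>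

lemma arc_length_right_continuous:
  fixes g :: "real \<Rightarrow> 'a::metric_space"
  assumes "rectifiable_path g"
  shows "continuous (at_right x) (arc_length g)"
proof -
  consider "x < 0" | "x \<ge> 1" | "0 \<le> x" "x < 1" by linarith
  then show ?thesis
  proof cases
    case 1
    have "eventually (\<lambda>y. arc_length g y = arc_length g x) (at_right x)"
      using eventually_at_right_real[OF 1] by eventually_elim (use 1 in \<open>simp add: arc_length_def\<close>)
    then show ?thesis unfolding continuous_within by (rule tendsto_eventually)
  next
    case 2
    have "eventually (\<lambda>y. arc_length g y = arc_length g x) (at_right x)"
      using eventually_at_right_less[of x] by eventually_elim (use 2 in \<open>simp add: arc_length_def\<close>)
    then show ?thesis unfolding continuous_within by (rule tendsto_eventually)
  next
    case 3
    have "eventually (\<lambda>s. dist (arc_length g s) (arc_length g x) < \<epsilon>) (at_right x)" if "\<epsilon> > 0" for \<epsilon>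
    proof -
      let ?V = "\<lambda>a b. Sup (polygonal_lengths g a b)"
      have "polygonal_lengths g x 1 \<noteq> {}"
        using dist_in_polygonal_lengths[of x 1 g] 3 by auto
      then obtain l where l: "l \<in> polygonal_lengths g x 1" "?V x 1 - \<epsilon> < l"
        using less_cSupE[of "?V x 1 - \<epsilon>" "polygonal_lengths g x 1"] \<open>\<epsilon> > 0\<close> by auto
      then obtain t k where t: "t 0 = x" "t k = 1" "\<forall>i<k. t i \<le> t (Suc i)"
        and l_eq: "l = (\<Sum>i<k. dist (g (t i)) (g (t (Suc i))))"
        unfolding polygonal_lengths_def by blast
      have t_ge: "i \<le> k \<Longrightarrow> x \<le> t i" for i
        using monotone_vertices[of 0 i k t] t by simp
      have t_le: "i \<le> k \<Longrightarrow> t i \<le> 1" for i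
        using monotone_vertices[of i k k t] t by simp
      define S where "S s = (\<Sum>i<k. dist (g (max (t i) s)) (g (max (t (Suc i)) s)))" for s
      have cg: "continuous_on {0..1} g"
        using assms by (simp add: rectifiable_path_def path_def)
      have "continuous_on {x..1} S"
        unfolding S_def
        by (intro continuous_intros continuous_on_compose2[OF cg])
          (use 3 t_ge t_le in \<open>force simp: max_def\<close>)+
      then have "(S \<longlongrightarrow> S x) (at x within {x..1})"
        using 3 by (auto simp: continuous_on_def)
      moreover have "S x = l"
        unfolding S_def l_eq using t_ge by (intro sum.cong) (simp_all add: max_absorb1)
      ultimately have "(S \<longlongrightarrow> l) (at_right x)"
        using 3 at_within_Icc_at_right by metis
      then have "eventually (\<lambda>s. S s > ?V x 1 - \<epsilon>) (at_right x)"
        using l(2) by (rule order_tendstoD)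
      moreover have "eventually (\<lambda>s. x < s \<and> s < 1) (at_right x)"
        using eventually_at_right_real[OF 3(2)] by simp
      ultimately show ?thesis
      proof eventually_elim
        case (elim s)
        have "S s \<in> polygonal_lengths g s 1"
          unfolding polygonal_lengths_def S_def using t elim
          by (intro CollectI exI[of _ "\<lambda>i. max (t i) s"] exI[of _ k]) (auto intro: max.mono)
        then have "S s \<le> ?V s 1"
          using elim 3 assms by (intro cSup_upper bdd_above_polygonal_lengths_subinterval) auto
        moreover have "?V x 1 = ?V x s + ?V s 1"
          using elim 3 assms by (intro Sup_polygonal_lengths_add) auto
        moreover have "arc_length g s - arc_length g x = ?V x s"
          using elim 3 assms by (intro arc_length_diff) auto
        moreover have "arc_length g x \<le> arc_length g s"
          using elim assms by (intro arc_length_mono) auto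
        ultimately show ?case using elim by (simp add: dist_real_def)
      qed
    qed
    then show ?thesis unfolding continuous_within tendsto_iff by blast
  qed
qed

lemma emeasure_arc_length_Ioc:
  assumes "rectifiable_path g" "a \<le> b"
  shows "emeasure (interval_measure (arc_length g)) {a<..b} = ennreal (arc_length g b - arc_length g a)"
  using assms by (intro emeasure_interval_measure_Ioc arc_length_mono arc_length_right_continuous)

lemma measure_arc_length_Ioc:
  assumes "rectifiable_path g" "a \<le> b"
  shows "measure (interval_measure (arc_length g)) {a<..b} = arc_length g b - arc_length g a"
  using assms by (intro measure_interval_measure_Ioc arc_length_mono arc_length_right_continuous)

lemma arc_length_nonpos: "x \<le> 0 \<Longrightarrow> arc_length g x = arc_length g 0"
  by (simp add: arc_length_def)

lemma emeasure_arc_length_unit_finite: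
  assumes "rectifiable_path g"
  shows "emeasure (interval_measure (arc_length g)) {0..1} < \<infinity>"
proof -
  have "emeasure (interval_measure (arc_length g)) {0..1} \<le> emeasure (interval_measure (arc_length g)) {-1<..1}"
    by (rule emeasure_mono) auto
  then show ?thesis using emeasure_arc_length_Ioc[OF assms, of "-1" 1] by (simp add: order_le_less_trans)
qed

text \<open>The point \<open>0\<close> carries no mass, because the arc length function is constant to its left.\<close>

lemma measure_arc_length_unit:
  assumes "rectifiable_path g"
  shows "measure (interval_measure (arc_length g)) {0..1} \<le> arc_length g 1 - arc_length g 0"
proof -
  have "measure (interval_measure (arc_length g)) {0..1} \<le> measure (interval_measure (arc_length g)) {-1<..1}"
    using emeasure_arc_length_Ioc[OF assms, of "-1" 1]
    by (intro measure_mono_fmeasurable) (auto simp: fmeasurable_def)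
  then show ?thesis using measure_arc_length_Ioc[OF assms, of "-1" 1] by (simp add: arc_length_nonpos[of "-1"])
qed

lemma set_integrable_along_path:
  assumes g: "rectifiable_path g" and \<phi>: "continuous_on (path_image g) \<phi>"
    and A: "A \<in> sets borel" "A \<subseteq> {0..1}"
  shows "set_integrable (interval_measure (arc_length g)) A (\<lambda>t. \<phi> (g t) :: real)"
proof -
  have cg: "continuous_on {0..1} g" and img: "g ` {0..1} = path_image g"
    using g by (simp_all add: rectifiable_path_def path_def path_image_def)
  have c: "continuous_on {0..1} (\<lambda>t. \<phi> (g t))"
    by (rule continuous_on_compose2[OF \<phi> cg]) (simp add: img)
  have "compact ((\<lambda>t. \<phi> (g t)) ` {0..1})"
    by (intro compact_continuous_image c) simp
  then obtain B where B: "\<And>t. t \<in> {0..1} \<Longrightarrow> norm (\<phi> (g t)) \<le> B"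
    by (meson bounded_iff compact_imp_bounded imageI)
  have "set_integrable (interval_measure (arc_length g)) {0..1} (\<lambda>t. \<phi> (g t))"
    unfolding set_integrable_def
  proof (rule Bochner_Integration.integrable_bound)
    show "integrable (interval_measure (arc_length g)) (\<lambda>t. indicator {0..1} t *\<^sub>R B)"
      using emeasure_arc_length_unit_finite[OF g] by auto
    show "(\<lambda>t. indicator {0..1} t *\<^sub>R \<phi> (g t)) \<in> borel_measurable (interval_measure (arc_length g))"
      using borel_measurable_continuous_on_indicator[OF _ c] by (simp cong: measurable_cong_sets)
    show "AE t in interval_measure (arc_length g). norm (indicator {0..1} t *\<^sub>R \<phi> (g t)) \<le> norm (indicator {0..1} t *\<^sub>R B)"
      using B by (intro AE_I2) (force simp: indicator_def)
  qed
  then show ?thesis by (rule set_integrable_subset) (use A in auto)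
qed

lemma arc_length_integral_nonneg:
  assumes "\<And>z. z \<in> path_image g \<Longrightarrow> 0 \<le> \<phi> z"
  shows "0 \<le> arc_length_integral g \<phi>"
  unfolding arc_length_integral_def set_lebesgue_integral_def using assms
  by (intro integral_nonneg_AE AE_I2) (auto simp: indicator_def path_image_def)

lemma arc_length_integral_le:
  assumes g: "rectifiable_path g" and \<phi>: "continuous_on (path_image g) \<phi>"
    and le: "\<And>z. z \<in> path_image g \<Longrightarrow> \<phi> z \<le> M" and "0 \<le> M"
  shows "arc_length_integral g \<phi> \<le> M * (arc_length g 1 - arc_length g 0)"
proof -
  have "arc_length_integral g \<phi> \<le> (LINT t:{0..1}|interval_measure (arc_length g). M)"
    unfolding arc_length_integral_def
  proof (rule set_integral_mono)
    show "set_integrable (interval_measure (arc_length g)) {0..1} (\<lambda>t. \<phi> (g t))"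
      by (rule set_integrable_along_path[OF g \<phi>]) auto
    show "set_integrable (interval_measure (arc_length g)) {0..1} (\<lambda>t. M)"
      using set_integrable_along_path[OF g, of "\<lambda>_. M" "{0..1}"] by simp
  qed (use le in \<open>auto simp: path_image_def\<close>)
  also have "\<dots> = M * measure (interval_measure (arc_length g)) {0..1}"
    using emeasure_arc_length_unit_finite[OF g] by (simp add: set_lebesgue_integral_def)
  also have "\<dots> \<le> M * (arc_length g 1 - arc_length g 0)"
    using measure_arc_length_unit[OF g] \<open>0 \<le> M\<close> by (intro mult_left_mono)
  finally show ?thesis .
qed

lemma polygonal_lengths_lipschitz:
  assumes "L-lipschitz_on {0..1} g" "x \<in> polygonal_lengths g 0 1"
  shows "x \<le> L"
proof -
  obtain t k where t: "t 0 = 0" "t k = 1" "\<forall>i<k. t i \<le> t (Suc i)"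
    and x: "x = (\<Sum>i<k. dist (g (t i)) (g (t (Suc i))))"
    using assms(2) unfolding polygonal_lengths_def by blast
  have t_ge: "i \<le> k \<Longrightarrow> 0 \<le> t i" for i
    using monotone_vertices[of 0 i k t] t by simp
  have t_le: "i \<le> k \<Longrightarrow> t i \<le> 1" for i
        using monotone_vertices[of i k k t] t by simp
  have "x \<le> (\<Sum>i<k. L * (t (Suc i) - t i))"
    unfolding x
  proof (rule sum_mono)
    fix i assume "i \<in> {..<k}"
    then have "dist (g (t i)) (g (t (Suc i))) \<le> L * dist (t i) (t (Suc i))"
      using t_ge[of i] t_ge[of "Suc i"] t_le[of i] t_le[of "Suc i"]
      by (intro lipschitz_onD[OF assms(1)]) auto
    then show "dist (g (t i)) (g (t (Suc i))) \<le> L * (t (Suc i) - t i)"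
      using t(3) \<open>i \<in> {..<k}\<close> by (simp add: dist_real_def)
  qed
  also have "\<dots> = L * (t k - t 0)"
    unfolding sum_distrib_left[symmetric] sum_lessThan_telescope ..
  finally show ?thesis using t by simp
qed

lemma lipschitz_rectifiable_path:
  assumes "L-lipschitz_on {0..1} g"
  shows "rectifiable_path g" "arc_length g 1 - arc_length g 0 \<le> L"
proof -
  have "path g"
    unfolding path_def using assms by (rule lipschitz_on_continuous_on)
  then show rect: "rectifiable_path g"
    unfolding rectifiable_path_def
    using polygonal_lengths_lipschitz[OF assms] by (metis bdd_above.I)
  have "Sup (polygonal_lengths g 0 1) \<le> L"
    using polygonal_lengths_lipschitz[OF assms] dist_in_polygonal_lengths[of 0 1 g]
    by (intro cSup_least) auto
  then show "arc_length g 1 - arc_length g 0 \<le> L"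
    using arc_length_diff[OF rect, of 0 1] by simp
qed

lemma linepath_lipschitz:
  fixes z w :: "'a::real_normed_vector"
  shows "(dist z w)-lipschitz_on {0..1} (linepath z w)"
proof (rule lipschitz_onI)
  fix s t :: real
  have "linepath z w s - linepath z w t = (s - t) *\<^sub>R (w - z)"
    by (simp add: linepath_def algebra_simps)
  then show "dist (linepath z w s) (linepath z w t) \<le> dist z w * dist s t"
    by (simp add: dist_norm norm_minus_commute)
qed simp

text \<open>Two points of a domain are joined by a polynomial path, which is Lipschitz on the unit interval.\<close>

lemma connected_open_rectifiable:
  fixes S :: "'a::euclidean_space set"
  assumes "open S" "connected S" "x \<in> S" "y \<in> S"
  obtains g where "rectifiable_path g" "path_image g \<subseteq> S" "pathstart g = x" "pathfinish g = y"
proof -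
  obtain g where g: "polynomial_function g" "path_image g \<subseteq> S" "pathstart g = x" "pathfinish g = y"
    using connected_open_polynomial_connected[OF assms] by blast
  obtain g' where g': "polynomial_function g'" "\<And>t. (g has_vector_derivative g' t) (at t)"
    using has_vector_derivative_polynomial_function[OF g(1)] by metis
  have "compact (g' ` {0..1})"
    using g'(1) by (intro compact_continuous_image continuous_on_polymonial_function) auto
  then obtain L where L: "\<And>t. t \<in> {0..1} \<Longrightarrow> norm (g' t) \<le> L"
    by (meson bounded_iff compact_imp_bounded imageI)
  have "L-lipschitz_on {0..1} g"
  proof (rule lipschitz_onI)
    fix s t :: real assume "s \<in> {0..1}" "t \<in> {0..1}"
    then have "norm (g s - g t) \<le> L * norm (s - t)"
    proof (intro differentiable_bound[where S = "{0..1}" and f' = "\<lambda>t h. h *\<^sub>R g' t"] onorm_le)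
      fix x h :: real assume "x \<in> {0..1}"
      then show "norm (h *\<^sub>R g' x) \<le> L * norm h"
        using mult_right_mono[OF L, of x "norm h"] by (simp add: mult.commute)
    qed (use g'(2) in \<open>auto simp: has_vector_derivative_def intro: has_derivative_at_withinI\<close>)
    then show "dist (g s) (g t) \<le> L * dist s t" by (simp add: dist_norm)
  next
    show "0 \<le> L" using order_trans[OF norm_ge_zero L[of 0]] by simp
  qed
  then show thesis
    using that g lipschitz_rectifiable_path(1) by blast
qed

section \<open>The mean value inequality on Euclidean balls\<close>

text \<open>By Fubini's theorem, the integral of \<open>1\<^sub>A(x) 1\<^sub>B(x + y)\<close> over \<open>\<lambda> \<otimes> \<mu>\<close> is
  both \<open>\<lambda>(A) \<mu>(B)\<close> and \<open>\<lambda>(B) \<mu>(-A)\<close> for translation invariant \<open>\<lambda>\<close>, \<open>\<mu>\<close>. With Lebesgue measure for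
  \<open>\<lambda>\<close>, its image under the isometry for \<open>\<mu>\<close> and the unit ball for \<open>A\<close>, this gives \<open>\<mu>(B) = \<lambda>(B)\<close>, as
  the ball is symmetric and invariant under the isometry.\<close>

lemma lborel_distr_linear_isometry:
  fixes T :: "'a::euclidean_space \<Rightarrow> 'a"
  assumes lin: "linear T" and iso: "\<And>x. norm (T x) = norm x"
  shows "distr lborel borel T = lborel"
proof -
  let ?\<mu> = "distr lborel borel T"
  let ?A = "ball (0::'a) 1"
  have inj: "inj T"
    using lin iso by (metis linear_injective_0 norm_eq_zero)
  then have surj: "surj T" using linear_inj_imp_surj[OF lin] by blast
  have T[measurable]: "T \<in> borel_measurable borel"
    using lin by (intro borel_measurable_continuous_onI linear_continuous_on) (simp add: linear_linear)
  have trans_mu: "distr ?\<mu> borel ((+) c) = ?\<mu>" for c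
  proof -
    obtain d where d: "c = T d" using surj by (metis surjD)
    have "distr ?\<mu> borel ((+) c) = distr lborel borel (\<lambda>x. T (d + x))"
      by (subst distr_distr) (auto simp: o_def d linear_add[OF lin])
    also have "\<dots> = distr (distr lborel borel ((+) d)) borel T"
      by (subst distr_distr) (auto simp: o_def)
    finally show ?thesis by (simp add: lborel_distr_plus)
  qed
  have mu_A: "emeasure ?\<mu> ?A = emeasure lborel ?A"
  proof -
    have "T -` ?A = ?A" by (auto simp: iso)
    then show ?thesis by (simp add: emeasure_distr)
  qed
  interpret mu: sigma_finite_measure ?\<mu>
  proof
    have "emeasure ?\<mu> (ball 0 (real n)) \<noteq> \<infinity>" for n
    proof -
      have "T -` ball 0 (real n) = ball 0 (real n)" by (auto simp: iso)
      then show ?thesis using emeasure_lborel_ball_finite[of "0::'a" "real n"] by (simp add: emeasure_distr less_top)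
    qed
    moreover have "(\<Union>n. ball 0 (real n)) = (UNIV :: 'a set)"
      using reals_Archimedean2 by (force simp: ball_def)
    ultimately show "\<exists>A. countable A \<and> A \<subseteq> sets ?\<mu> \<and> \<Union> A = space ?\<mu> \<and> (\<forall>a\<in>A. emeasure ?\<mu> a \<noteq> \<infinity>)"
      by (intro exI[of _ "range (\<lambda>n. ball 0 (real n))"]) auto
  qed
  interpret pair_sigma_finite lborel ?\<mu> ..
  have sets: "sets (lborel \<Otimes>\<^sub>M ?\<mu>) = sets (borel \<Otimes>\<^sub>M borel)"
    by (intro sets_pair_measure_cong) auto
  have [measurable]: "?A \<in> sets borel" by simp
  show ?thesis
  proof (rule measure_eqI)
    fix B assume "B \<in> sets ?\<mu>"
    then have [measurable]: "B \<in> sets borel" by simp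
    have "emeasure lborel ?A * emeasure ?\<mu> B
        = (\<integral>\<^sup>+x. \<integral>\<^sup>+y. indicator ?A x * indicator B (x + y) \<partial>?\<mu> \<partial>lborel)"
    proof -
      have "(\<integral>\<^sup>+y. indicator ?A x * indicator B (x + y) \<partial>?\<mu>) = indicator ?A x * emeasure ?\<mu> B" for x
      proof -
        have "(\<integral>\<^sup>+y. indicator B (x + y) \<partial>?\<mu>) = (\<integral>\<^sup>+y. indicator B y \<partial>(distr ?\<mu> borel ((+) x)))"
          by (subst nn_integral_distr) auto
        also have "\<dots> = emeasure ?\<mu> B" unfolding trans_mu by simp
        finally show ?thesis by (subst nn_integral_cmult) auto
      qed
      then show ?thesis by (simp only:) (subst nn_integral_multc, auto intro!: borel_measurable_indicator)
    qed
    also have "\<dots> = (\<integral>\<^sup>+y. \<integral>\<^sup>+x. indicator ?A x * indicator B (x + y) \<partial>lborel \<partial>?\<mu>)"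
      by (rule Fubini'[symmetric], subst measurable_cong_sets[OF sets refl]) (simp add: split_beta', measurable)
    also have "\<dots> = (\<integral>\<^sup>+y. \<integral>\<^sup>+x. indicator ?A (x - y) * indicator B x \<partial>lborel \<partial>?\<mu>)"
    proof (rule nn_integral_cong)
      fix y
      have "(\<integral>\<^sup>+x. indicator ?A (x - y) * indicator B x \<partial>lborel)
          = (\<integral>\<^sup>+x. indicator ?A (x - y) * indicator B x \<partial>(distr lborel borel ((+) y)))"
        by (simp add: lborel_distr_plus)
      also have "\<dots> = (\<integral>\<^sup>+x. indicator ?A x * indicator B (x + y) \<partial>lborel)"
        by (subst nn_integral_distr) (auto simp: add.commute)
      finally show "(\<integral>\<^sup>+x. indicator ?A x * indicator B (x + y) \<partial>lborel)
        = (\<integral>\<^sup>+x. indicator ?A (x - y) * indicator B x \<partial>lborel)" ..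
    qed
    also have "\<dots> = (\<integral>\<^sup>+x. \<integral>\<^sup>+y. indicator ?A (x - y) * indicator B x \<partial>?\<mu> \<partial>lborel)"
      by (rule Fubini', subst measurable_cong_sets[OF sets refl]) (simp add: split_beta', measurable)
    also have "\<dots> = (\<integral>\<^sup>+x. emeasure ?\<mu> ?A * indicator B x \<partial>lborel)"
    proof (rule nn_integral_cong)
      fix x
      have "(\<integral>\<^sup>+y. indicator ?A (x - y) \<partial>?\<mu>) = (\<integral>\<^sup>+y. indicator ?A (- x + y) \<partial>?\<mu>)"
        by (rule nn_integral_cong) (simp add: indicator_def dist_norm norm_minus_commute)
      also have "\<dots> = (\<integral>\<^sup>+y. indicator ?A y \<partial>(distr ?\<mu> borel ((+) (- x))))"
        by (subst nn_integral_distr) auto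
      also have "\<dots> = emeasure ?\<mu> ?A" unfolding trans_mu by simp
      finally show "(\<integral>\<^sup>+y. indicator ?A (x - y) * indicator B x \<partial>?\<mu>) = emeasure ?\<mu> ?A * indicator B x"
        by (subst nn_integral_multc) auto
    qed
    also have "\<dots> = emeasure lborel ?A * emeasure lborel B"
      by (simp add: nn_integral_cmult mu_A)
    finally have "emeasure lborel ?A * emeasure ?\<mu> B = emeasure lborel ?A * emeasure lborel B" .
    moreover have "emeasure lborel ?A \<noteq> 0" "emeasure lborel ?A \<noteq> \<infinity>"
      using content_ball_pos[of 1 "0::'a"] emeasure_lborel_ball_finite[of "0::'a" 1]
      by (auto simp: measure_def)
    ultimately show "emeasure ?\<mu> B = emeasure lborel B"
      by (simp add: ennreal_mult_cancel_left)
  qed simp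
qed

lemma norm_vec_scalar_mult:
  fixes x :: "complex ^ 'n::finite"
  shows "norm (c *s x) = norm c * norm x"
  unfolding norm_vec_def vector_scalar_mult_def by (simp add: norm_mult L2_set_right_distrib)

lemma linear_vec_scalar_mult: "linear (\<lambda>x :: complex ^ 'n::finite. c *s x)"
  by (rule linearI) (simp_all add: vec_eq_iff algebra_simps)

lemma continuous_on_vec_scalar_mult [continuous_intros]:
  fixes h :: "'a::topological_space \<Rightarrow> complex ^ 'n::finite"
  assumes "continuous_on S c" "continuous_on S h"
  shows "continuous_on S (\<lambda>x. c x *s h x)"
  unfolding vector_scalar_mult_def by (intro continuous_intros assms)

lemma set_integrable_ball:
  fixes F :: "'a::euclidean_space \<Rightarrow> real"
  assumes "continuous_on (cball w \<rho>) F"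
  shows "set_integrable lborel (ball w \<rho>) F"
proof -
  have "set_integrable lborel (cball w \<rho>) F"
    unfolding set_integrable_def using assms by (intro borel_integrable_compact) auto
  then show ?thesis by (rule set_integrable_subset) auto
qed

text \<open>Averaging the inequality over the circles about \<open>w\<close> through the points \<open>w + \<zeta>\<close> of the ball
  replaces each \<open>\<zeta>\<close> by its rotations, which does not change the integral over the ball.\<close>

lemma circle_submean_imp_ball_submean:
  fixes G :: "complex ^ 'n::finite \<Rightarrow> real"
  assumes cont': "continuous_on (cball w \<rho>) G" and nonneg: "\<And>z. 0 \<le> G z"
    and circle: "\<And>\<zeta>. norm \<zeta> < \<rho> \<Longrightarrow> G w \<le> integral {0..1} (\<lambda>t. G (w + exp (2 * of_real pi * \<i> * of_real t) *s \<zeta>))"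
  shows "measure lborel (ball w \<rho>) * G w \<le> (LINT z:ball w \<rho>|lborel. G z)"
proof -
  have cont: "continuous_on (ball w \<rho>) G"
    using cont' by (rule continuous_on_subset) auto
  define e :: "real \<Rightarrow> complex" where "e t = exp (2 * of_real pi * \<i> * of_real t)" for t
  have norm_e: "norm (e t) = 1" for t by (simp add: e_def norm_exp_eq_Re)
  have cont_e: "continuous_on S e" for S unfolding e_def by (intro continuous_intros)
  define H :: "complex ^ 'n \<Rightarrow> real" where "H z = indicator (ball w \<rho>) z *\<^sub>R G z" for z
  have H[measurable]: "H \<in> borel_measurable borel"
    unfolding H_def by (rule borel_measurable_continuous_on_indicator[OF _ cont]) auto
  have rot[measurable]: "(\<lambda>(t, \<zeta>). w + e t *s \<zeta>) \<in> borel_measurable (borel \<Otimes>\<^sub>M borel)"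
    unfolding split_beta' borel_prod
    by (intro borel_measurable_continuous_onI continuous_intros continuous_on_compose2[OF cont_e[of UNIV]]) auto
  have rot': "(\<lambda>\<zeta>. w + e t *s \<zeta>) \<in> borel_measurable borel" for t
    by (intro borel_measurable_continuous_onI continuous_intros)
  have *: "(\<integral>\<^sup>+\<zeta>. ennreal (H (w + e t *s \<zeta>)) \<partial>lborel) = (\<integral>\<^sup>+z. ennreal (H z) \<partial>lborel)" for t
  proof -
    have "(\<integral>\<^sup>+z. ennreal (H z) \<partial>lborel) = (\<integral>\<^sup>+z. ennreal (H z) \<partial>distr lborel borel ((+) w))"
      by (simp add: lborel_distr_plus)
    also have "\<dots> = (\<integral>\<^sup>+z. ennreal (H (w + z)) \<partial>lborel)"
      by (subst nn_integral_distr) auto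
    also have "\<dots> = (\<integral>\<^sup>+z. ennreal (H (w + z)) \<partial>distr lborel borel (\<lambda>\<zeta>. e t *s \<zeta>))"
      by (subst lborel_distr_linear_isometry)
        (auto simp: linear_vec_scalar_mult norm_vec_scalar_mult norm_e)
    also have "\<dots> = (\<integral>\<^sup>+\<zeta>. ennreal (H (w + e t *s \<zeta>)) \<partial>lborel)"
      by (subst nn_integral_distr) (auto intro!: borel_measurable_continuous_onI continuous_intros)
    finally show ?thesis ..
  qed
  have "emeasure lborel (ball w \<rho>) * ennreal (G w) = (\<integral>\<^sup>+z. ennreal (G w) * indicator (ball w \<rho>) z \<partial>lborel)"
    by (subst nn_integral_cmult_indicator) (auto simp: mult.commute)
  also have "\<dots> = (\<integral>\<^sup>+z. ennreal (G w) * indicator (ball w \<rho>) z \<partial>distr lborel borel ((+) w))"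
    by (simp add: lborel_distr_plus)
  also have "\<dots> = (\<integral>\<^sup>+\<zeta>. ennreal (G w) * indicator (ball w \<rho>) (w + \<zeta>) \<partial>lborel)"
    by (subst nn_integral_distr) (auto intro!: borel_measurable_times_ennreal borel_measurable_indicator)
  also have "\<dots> \<le> (\<integral>\<^sup>+\<zeta>. \<integral>\<^sup>+t. ennreal (H (w + e t *s \<zeta>)) * indicator {0..1} t \<partial>lborel \<partial>lborel)"
  proof (rule nn_integral_mono)
    fix \<zeta> :: "complex ^ 'n"
    show "ennreal (G w) * indicator (ball w \<rho>) (w + \<zeta>)
      \<le> (\<integral>\<^sup>+t. ennreal (H (w + e t *s \<zeta>)) * indicator {0..1} t \<partial>lborel)"
    proof (cases "norm \<zeta> < \<rho>")
      case True
      have in_ball: "w + e t *s \<zeta> \<in> ball w \<rho>" for t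
        using True by (simp add: dist_norm norm_vec_scalar_mult norm_e)
      have c: "continuous_on {0..1} (\<lambda>t. G (w + e t *s \<zeta>))"
        by (intro continuous_on_compose2[OF cont] continuous_intros cont_e) (use in_ball in auto)
      have "ennreal (G w) \<le> ennreal (integral {0..1} (\<lambda>t. G (w + e t *s \<zeta>)))"
        using circle[OF True] unfolding e_def by (rule ennreal_leI)
      also have "\<dots> = (\<integral>\<^sup>+t. ennreal (indicator {0..1} t *\<^sub>R G (w + e t *s \<zeta>)) \<partial>lborel)"
      proof -
        have "set_integrable lborel {0..1} (\<lambda>t. G (w + e t *s \<zeta>))"
          using c by (intro borel_integrable_compact[unfolded set_integrable_def[symmetric]]) auto
        then show ?thesis
          using set_borel_integral_eq_integral(2)[of "{0..1}" "\<lambda>t. G (w + e t *s \<zeta>)"] nonneg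
          unfolding set_integrable_def set_lebesgue_integral_def
          by (subst nn_integral_eq_integral) (auto intro!: AE_I2)
      qed
      also have "\<dots> = (\<integral>\<^sup>+t. ennreal (H (w + e t *s \<zeta>)) * indicator {0..1} t \<partial>lborel)"
        using in_ball by (intro nn_integral_cong) (auto simp: H_def indicator_def)
      finally show ?thesis using True by (simp add: indicator_def dist_norm)
    qed (simp add: dist_norm)
  qed
  also have "\<dots> = (\<integral>\<^sup>+t. \<integral>\<^sup>+\<zeta>. ennreal (H (w + e t *s \<zeta>)) * indicator {0..1} t \<partial>lborel \<partial>lborel)"
  proof (rule lborel_pair.Fubini')
    have "(\<lambda>(t, \<zeta>). ennreal (H (w + e t *s \<zeta>)) * indicator {0..1} t) \<in> borel_measurable (borel \<Otimes>\<^sub>M borel)"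
      using measurable_compose[OF rot, of "\<lambda>z. ennreal (H z)" borel] unfolding split_beta' by measurable
    then show "(\<lambda>(t, \<zeta>). ennreal (H (w + e t *s \<zeta>)) * indicator {0..1} t) \<in> borel_measurable (lborel \<Otimes>\<^sub>M lborel)"
      by (simp cong: measurable_cong_sets sets_pair_measure_cong)
  qed
  also have "\<dots> = (\<integral>\<^sup>+t. (\<integral>\<^sup>+z. ennreal (H z) \<partial>lborel) * indicator {0..1::real} t \<partial>lborel)"
    using measurable_compose[OF rot'[unfolded measurable_lborel2[symmetric]]]
    by (intro nn_integral_cong, subst nn_integral_multc) (auto simp: *)
  also have "\<dots> = (\<integral>\<^sup>+z. ennreal (H z) \<partial>lborel)"
    by (subst nn_integral_cmult_indicator) auto
  also have "\<dots> = ennreal (LINT z:ball w \<rho>|lborel. G z)"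
    unfolding set_lebesgue_integral_def H_def
    using set_integrable_ball[OF cont'] nonneg
    by (intro nn_integral_eq_integral) (auto simp: set_integrable_def)
  finally have "ennreal (measure lborel (ball w \<rho>) * G w) \<le> ennreal (LINT z:ball w \<rho>|lborel. G z)"
    using emeasure_lborel_ball_finite[of w \<rho>] nonneg
    by (simp add: ennreal_mult emeasure_eq_ennreal_measure less_top)
  then show ?thesis
    using nonneg by (subst (asm) ennreal_le_iff) (auto simp: set_lebesgue_integral_def intro!: integral_nonneg_AE)
qed

text \<open>For \<open>p \<ge> 1\<close>, the inequality \<open>G \<le> \<lambda> + \<lambda>\<^bsup>1-p\<^esup> G\<^bsup>p\<^esup>\<close> with \<open>\<lambda> = G z / 2\<close> passes from \<open>G\<close> to \<open>G\<^bsup>p\<^esup>\<close>: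
  the constant term is absorbed into the left-hand side.
  For \<open>p < 1\<close>, let \<open>A\<close> be the maximum of \<open>(R - |w - z|)\<^bsup>N/p\<^esup> G w\<close>, with \<open>N\<close> the dimension. In the
  mean value inequality for the ball about the maximum point with half the distance to the sphere
  as radius, all factors but \<open>G\<^bsup>p\<^esup>\<close> in \<open>G = G\<^bsup>p\<^esup> G\<^bsup>1-p\<^esup>\<close> are controlled by \<open>A\<close>; the exponent \<open>N/p\<close> makes
  the powers of the radius cancel and leaves an upper bound for \<open>A\<^bsup>p\<^esup>\<close>.\<close>

lemma submean_power:
  fixes G :: "'a::euclidean_space \<Rightarrow> real"
  assumes cont: "continuous_on (cball z R) G" and nonneg: "\<And>x. 0 \<le> G x" and "0 < R" "0 < p"
    and submean: "\<And>w \<rho>. 0 < \<rho> \<Longrightarrow> cball w \<rho> \<subseteq> cball z R \<Longrightarrow>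
      measure lborel (ball w \<rho>) * G w \<le> (LINT x:ball w \<rho>|lborel. G x)"
  shows "measure lborel (ball z R) * G z powr p
    \<le> 2 powr (p + DIM('a) / p) * (LINT x:ball z R|lborel. G x powr p)"
proof -
  define J where "J = (LINT x:ball z R|lborel. G x powr p)"
  have int_p: "set_integrable lborel (ball w \<rho>) (\<lambda>x. G x powr p)" if "cball w \<rho> \<subseteq> cball z R" for w \<rho>
    using that \<open>0 < p\<close> nonneg
    by (intro set_integrable_ball continuous_on_powr' continuous_on_subset[OF cont] continuous_on_const) auto
  have int: "set_integrable lborel (ball w \<rho>) G" if "cball w \<rho> \<subseteq> cball z R" for w \<rho>
    using that by (intro set_integrable_ball continuous_on_subset[OF cont])
  have J_nonneg: "0 \<le> J"
    unfolding J_def set_lebesgue_integral_def by (intro integral_nonneg_AE AE_I2) simp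
  have J_sub: "(LINT x:ball w \<rho>|lborel. G x powr p) \<le> J" if "cball w \<rho> \<subseteq> cball z R" "ball w \<rho> \<subseteq> ball z R" for w \<rho>
    unfolding J_def set_lebesgue_integral_def
    using int_p[OF that(1)] int_p[of z R] that(2)
    by (intro integral_mono) (auto simp: set_integrable_def indicator_def)
  consider "G z = 0" | "G z > 0" "p \<ge> 1" | "G z > 0" "p < 1"
    using nonneg[of z] by linarith
  then show ?thesis
  proof cases
    case 1
    then show ?thesis using J_nonneg by (simp add: J_def)
  next
    case 2
    define m where "m = measure lborel (ball z R)"
    define l where "l = G z / 2"
    have l: "l > 0" using 2 by (simp add: l_def)
    have G_le: "G x \<le> l + l powr (1 - p) * G x powr p" for x
    proof (cases "G x \<le> l")
      case True
      then show ?thesis by (simp add: add_increasing2)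
    next
      case False
      then have "G x powr (1 - p) \<le> l powr (1 - p)"
        using 2 l by (intro powr_mono2') auto
      then have "G x powr (1 - p) * G x powr p \<le> l powr (1 - p) * G x powr p"
        by (intro mult_right_mono) auto
      then show ?thesis using False l by (simp flip: powr_add)
    qed
    have "m * G z \<le> (LINT x:ball z R|lborel. G x)"
      unfolding m_def using \<open>0 < R\<close> by (intro submean) auto
    also have "\<dots> \<le> (LINT x:ball z R|lborel. l + l powr (1 - p) * G x powr p)"
      using int[of z R] int_p[of z R] G_le set_integrable_ball[of z R "\<lambda>_. l"]
      by (intro set_integral_mono set_integral_add set_integrable_mult_right) auto
    also have "\<dots> = l * m + l powr (1 - p) * J"
      using int_p[of z R] set_integrable_ball[of z R "\<lambda>_. l"] emeasure_lborel_ball_finite[of z R]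
      by (subst set_integral_add) (auto simp: J_def m_def set_lebesgue_integral_def)
    moreover have "m * G z = 2 * (l * m)" by (simp add: l_def)
    ultimately have "m * l \<le> l powr (1 - p) * J" by (simp add: mult.commute)
    then have "l powr (p - 1) * (m * l) \<le> l powr (p - 1) * (l powr (1 - p) * J)"
      by (intro mult_left_mono) auto
    also have "\<dots> = J" using l by (simp add: mult.assoc[symmetric] flip: powr_add)
    also have "l powr (p - 1) * (m * l) = m * l powr p"
      using l by (simp add: powr_diff)
    finally have *: "m * l powr p \<le> J" .
    have "m * G z powr p = 2 powr p * (m * l powr p)"
      using 2 by (simp add: l_def powr_divide)
    also have "\<dots> \<le> 2 powr p * J" using * by (intro mult_left_mono) auto
    also have "\<dots> \<le> 2 powr (p + DIM('a) / p) * J"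
      using J_nonneg \<open>0 < p\<close> by (intro mult_right_mono powr_mono) auto
    finally show ?thesis by (simp add: m_def J_def)
  next
    case 3
    define k where "k = DIM('a) / p"
    have k: "k > 0" "k * p = DIM('a)" using \<open>0 < p\<close> by (simp_all add: k_def)
    define h where "h w = (R - dist z w) powr k * G w" for w
    have "continuous_on (cball z R) h"
      unfolding h_def using k by (intro continuous_intros cont continuous_on_powr') auto
    then obtain w0 where w0: "w0 \<in> cball z R" and max: "\<And>w. w \<in> cball z R \<Longrightarrow> h w \<le> h w0"
      using continuous_attains_sup[of "cball z R" h] \<open>0 < R\<close> by auto
    define A where "A = h w0"
    have h_z: "R powr k * G z \<le> A" using max[of z] \<open>0 < R\<close> by (simp add: A_def h_def)
    have "0 < R powr k * G z" using 3 \<open>0 < R\<close> by simp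
    then have A: "A > 0" using h_z by linarith
    define \<rho> where "\<rho> = (R - dist z w0) / 2"
    have \<rho>: "\<rho> > 0"
    proof (rule ccontr)
      assume "\<not> \<rho> > 0"
      then have "R - dist z w0 = 0" using w0 by (simp add: \<rho>_def)
      then show False using A by (simp add: A_def h_def)
    qed
    have sub: "dist z x \<le> R - \<rho>" if "dist w0 x \<le> \<rho>" for x
      using dist_triangle[of z x w0] that by (simp add: \<rho>_def field_simps)
    have subset: "cball w0 \<rho> \<subseteq> cball z R" "ball w0 \<rho> \<subseteq> ball z R"
      using sub \<rho> by (force simp: subset_eq dest: less_imp_le)+
    define c where "c = (A * \<rho> powr (- k)) powr (1 - p)"
    have G_le: "G x \<le> c * G x powr p" if "x \<in> ball w0 \<rho>" for x
    proof (cases "G x = 0")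
      case False
      then have Gx: "G x > 0" using nonneg[of x] by simp
      have "\<rho> powr k * G x \<le> (R - dist z x) powr k * G x"
        using sub[of x] that \<rho> k nonneg by (intro mult_right_mono powr_mono2) auto
      also have "\<dots> \<le> A" using max[of x] subset that by (auto simp: A_def h_def)
      finally have "G x \<le> A * \<rho> powr (- k)"
        using \<rho> by (simp add: powr_minus field_simps)
      then have "G x powr (1 - p) \<le> c" unfolding c_def
        using 3 Gx by (intro powr_mono2) auto
      then have "G x powr (1 - p) * G x powr p \<le> c * G x powr p"
        by (intro mult_right_mono) auto
      then show ?thesis using Gx by (simp flip: powr_add)
    qed simp
    define \<omega> where "\<omega> = measure lborel (ball (0::'a) 1)"
    have ball_eq: "measure lborel (ball w r) = \<omega> * r powr DIM('a)" if "r > 0" for w :: 'a and r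
      using content_ball_conv_unit_ball[of r w] that by (simp add: \<omega>_def powr_realpow)
    have "\<omega> * \<rho> powr DIM('a) * G w0 \<le> (LINT x:ball w0 \<rho>|lborel. G x)"
      using submean[OF \<rho> subset(1)] ball_eq[OF \<rho>] by simp
    also have "\<dots> \<le> (LINT x:ball w0 \<rho>|lborel. c * G x powr p)"
      using int[OF subset(1)] int_p[OF subset(1)] G_le
      by (intro set_integral_mono set_integrable_mult_right) auto
    also have "\<dots> \<le> c * J"
      using J_sub[OF subset] by (simp add: c_def mult_left_mono)
    finally have *: "\<omega> * \<rho> powr DIM('a) * G w0 \<le> c * J" .
    have A_eq: "A = (2 * \<rho>) powr k * G w0"
    proof -
      have "2 * \<rho> = R - dist z w0" by (simp add: \<rho>_def)
      then show ?thesis by (simp add: A_def h_def)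
    qed
    \<comment> \<open>As \<open>k p\<close> is the dimension, the powers of \<open>\<rho>\<close> in \<open>c\<close> match those that arise from the volume of
      the ball and from the factor \<open>\<rho>\<^bsup>k\<^esup>\<close> in \<open>A\<close>.\<close>
    have c_eq: "c = A powr (1 - p) * (\<rho> powr (- k) * \<rho> powr DIM('a))"
    proof -
      have "- k * (1 - p) = - k + DIM('a)" using k by (simp add: algebra_simps)
      then have "c = A powr (1 - p) * \<rho> powr (- k + DIM('a))"
        unfolding c_def using A \<rho> by (simp add: powr_mult powr_powr)
      then show ?thesis by (simp only: powr_add)
    qed
    have "\<omega> * A * \<rho> powr DIM('a) = 2 powr k * \<rho> powr k * (\<omega> * \<rho> powr DIM('a) * G w0)"
      unfolding A_eq using \<rho> by (simp add: powr_mult)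
    also have "\<dots> \<le> 2 powr k * \<rho> powr k * (c * J)"
      using * by (intro mult_left_mono) auto
    also have "\<dots> = (2 powr k * A powr (1 - p) * J) * \<rho> powr DIM('a)"
      unfolding c_eq using \<rho> by (simp add: powr_minus field_simps)
    finally have "\<omega> * A \<le> 2 powr k * A powr (1 - p) * J"
      using \<rho> by (simp add: mult_le_cancel_right)
    then have "A powr (p - 1) * (\<omega> * A) \<le> A powr (p - 1) * (2 powr k * A powr (1 - p) * J)"
      by (intro mult_left_mono) auto
    also have "\<dots> = 2 powr k * J"
      using A by (simp add: powr_diff field_simps)
    also have "A powr (p - 1) * (\<omega> * A) = \<omega> * A powr p"
      using A by (simp add: powr_diff)
    finally have **: "\<omega> * A powr p \<le> 2 powr k * J" .
    have "measure lborel (ball z R) * G z powr p = \<omega> * (R powr k * G z) powr p"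
      using ball_eq[OF \<open>0 < R\<close>] nonneg \<open>0 < R\<close> k by (simp add: powr_mult powr_powr)
    also have "\<dots> \<le> \<omega> * A powr p"
      using h_z \<open>0 < p\<close> \<open>0 < R\<close> nonneg by (intro mult_left_mono powr_mono2) (auto simp: \<omega>_def)
    also have "\<dots> \<le> 2 powr k * J" by (rule **)
    also have "\<dots> \<le> 2 powr (p + k) * J"
      using J_nonneg \<open>0 < p\<close> by (intro mult_right_mono powr_mono) auto
    finally show ?thesis by (simp add: J_def k_def)
  qed
qed

section \<open>Internal Lipschitz spaces\<close>

locale majorant_domain =
  fixes \<psi> :: "real \<Rightarrow> real" and \<Omega> :: "'a::euclidean_space set"
  assumes majorant: "majorant \<psi>"
    and open_domain: "open \<Omega>" and connected_domain: "connected \<Omega>"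
    and nonempty_domain: "\<Omega> \<noteq> {}" and bounded_domain: "bounded \<Omega>"
begin

definition weight :: "'a \<Rightarrow> real" where
  "weight z = \<psi> (bdist \<Omega> z) / bdist \<Omega> z"

lemma frontier_nonempty: "frontier \<Omega> \<noteq> {}"
  using nonempty_domain bounded_domain not_bounded_UNIV by (auto simp: frontier_eq_empty)

lemma bdist_pos:
  assumes "z \<in> \<Omega>"
  shows "0 < bdist \<Omega> z"
proof -
  have "z \<notin> frontier \<Omega>" using assms open_domain by (simp add: frontier_def interior_open)
  then show ?thesis
    unfolding bdist_def using frontier_nonempty by (intro infdist_pos_not_in_closed) auto
qed

lemma ball_bdist_subset:
  assumes "z \<in> \<Omega>"
  shows "ball z (bdist \<Omega> z) \<subseteq> \<Omega>"
proof (rule ccontr)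
  assume "\<not> ?thesis"
  moreover have "z \<in> ball z (bdist \<Omega> z) \<inter> \<Omega>" using assms bdist_pos by simp
  ultimately have "ball z (bdist \<Omega> z) \<inter> frontier \<Omega> \<noteq> {}"
    by (intro connected_Int_frontier connected_ball) blast+
  then obtain w where "dist z w < bdist \<Omega> z" "w \<in> frontier \<Omega>" by auto
  then show False using infdist_le[of w "frontier \<Omega>" z] by (simp add: bdist_def)
qed

lemma half_ball_subset:
  assumes "z \<in> \<Omega>"
  shows "cball z (bdist \<Omega> z / 2) \<subseteq> \<Omega>"
  using bdist_pos[OF assms]
  by (intro order_trans[OF _ ball_bdist_subset[OF assms]]) (simp add: cball_subset_ball_iff)

lemma weight_nonneg: "0 \<le> weight z"
  using majorant by (simp add: weight_def majorant_def bdist_def infdist_nonneg)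

lemma continuous_on_weight: "continuous_on \<Omega> weight"
proof -
  have bd: "continuous_on \<Omega> (bdist \<Omega>)"
    unfolding bdist_def by (intro continuous_intros)
  have "continuous_on {0..} \<psi>" using majorant by (simp add: majorant_def)
  then have "continuous_on \<Omega> (\<lambda>z. \<psi> (bdist \<Omega> z))"
    using bd by (rule continuous_on_compose2) (auto simp: bdist_def infdist_nonneg)
  then show ?thesis
    unfolding weight_def[abs_def] using bd by (rule continuous_on_divide) (auto dest: bdist_pos)
qed

text \<open>The weight is comparable on the half-size ball because \<open>\<psi>(t)/t\<close> is non-increasing and
  \<open>\<psi>(t/2) \<le> \<psi>(t)\<close>.\<close>

lemma weight_half_ball:
  assumes z: "z \<in> \<Omega>" and w: "w \<in> cball z (bdist \<Omega> z / 2)"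
  shows "weight w \<le> 2 * weight z"
proof -
  let ?d = "bdist \<Omega> z"
  have d: "0 < ?d" using z by (rule bdist_pos)
  have "?d \<le> bdist \<Omega> w + dist z w"
    unfolding bdist_def by (rule infdist_triangle)
  then have "?d / 2 \<le> bdist \<Omega> w" using w by simp
  moreover have "antimono_on {0<..} (\<lambda>t. \<psi> t / t)" using majorant by (simp add: majorant_def)
  ultimately have "weight w \<le> \<psi> (?d / 2) / (?d / 2)"
    using d monotone_onD[of "{0<..}" "(\<le>)" "(\<ge>)" "\<lambda>t. \<psi> t / t" "?d / 2" "bdist \<Omega> w"]
    by (auto simp: weight_def)
  also have "\<dots> \<le> \<psi> ?d / (?d / 2)"
    using majorant d unfolding majorant_def by (intro divide_right_mono) (auto simp: mono_on_def)
  finally show ?thesis by (simp add: weight_def mult.commute)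
qed

lemma bdd_below_path_integrals:
  "bdd_below {arc_length_integral g (\<lambda>z. \<psi> (bdist \<Omega> z) / bdist \<Omega> z) | g.
      rectifiable_path g \<and> path_image g \<subseteq> \<Omega> \<and> pathstart g = z1 \<and> pathfinish g = z2}"
  using weight_nonneg unfolding weight_def
  by (intro bdd_belowI[of _ 0]) (auto intro: arc_length_integral_nonneg)

lemma internal_dist_le:
  assumes "rectifiable_path g" "path_image g \<subseteq> \<Omega>" "pathstart g = z1" "pathfinish g = z2"
  shows "internal_dist \<psi> \<Omega> z1 z2 \<le> arc_length_integral g weight"
  unfolding internal_dist_def weight_def[abs_def]
  using assms by (intro cInf_lower bdd_below_path_integrals) blast

text \<open>That some rectifiable curve joins the points is essential here: the infimum of the empty set
  of reals has no prescribed value.\<close>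

lemma internal_dist_greatest:
  assumes "z1 \<in> \<Omega>" "z2 \<in> \<Omega>"
    and "\<And>g. rectifiable_path g \<Longrightarrow> path_image g \<subseteq> \<Omega> \<Longrightarrow> pathstart g = z1 \<Longrightarrow> pathfinish g = z2 \<Longrightarrow>
      c \<le> arc_length_integral g weight"
  shows "c \<le> internal_dist \<psi> \<Omega> z1 z2"
  unfolding internal_dist_def
proof (rule cInf_greatest)
  obtain g where "rectifiable_path g" "path_image g \<subseteq> \<Omega>" "pathstart g = z1" "pathfinish g = z2"
    using connected_open_rectifiable[OF open_domain connected_domain assms(1,2)] .
  then show "{arc_length_integral g (\<lambda>z. \<psi> (bdist \<Omega> z) / bdist \<Omega> z) | g.
      rectifiable_path g \<and> path_image g \<subseteq> \<Omega> \<and> pathstart g = z1 \<and> pathfinish g = z2} \<noteq> {}"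
    by blast
qed (use assms(3) in \<open>auto simp: weight_def[abs_def]\<close>)

lemma internal_dist_half_ball:
  assumes z: "z \<in> \<Omega>" and w: "w \<in> cball z (bdist \<Omega> z / 2)"
  shows "internal_dist \<psi> \<Omega> z w \<le> 2 * weight z * dist z w"
proof -
  let ?g = "linepath z w"
  have img: "path_image ?g \<subseteq> cball z (bdist \<Omega> z / 2)"
    unfolding path_image_linepath
    using w bdist_pos[OF z] by (intro closed_segment_subset) auto
  then have img': "path_image ?g \<subseteq> \<Omega>" using half_ball_subset[OF z] by blast
  have "internal_dist \<psi> \<Omega> z w \<le> arc_length_integral ?g weight"
    using img' by (intro internal_dist_le lipschitz_rectifiable_path(1)[OF linepath_lipschitz]) auto
  also have "\<dots> \<le> 2 * weight z * (arc_length ?g 1 - arc_length ?g 0)"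
    using img weight_half_ball[OF z] weight_nonneg
    by (intro arc_length_integral_le lipschitz_rectifiable_path(1)[OF linepath_lipschitz]
        continuous_on_subset[OF continuous_on_weight img']) auto
  also have "\<dots> \<le> 2 * weight z * dist z w"
    using weight_nonneg by (intro mult_left_mono lipschitz_rectifiable_path(2) linepath_lipschitz) auto
  finally show ?thesis .
qed

lemma internal_Lipschitz_half_ball:
  assumes "F \<in> internal_Lipschitz \<psi> \<Omega>"
  obtains C where "C > 0"
    "\<And>z w. z \<in> \<Omega> \<Longrightarrow> w \<in> cball z (bdist \<Omega> z / 2) \<Longrightarrow> norm (F w - F z) \<le> C * weight z * dist z w"
proof -
  obtain C where C: "C > 0" "\<And>z w. z \<in> \<Omega> \<Longrightarrow> w \<in> \<Omega> \<Longrightarrow> norm (F z - F w) \<le> C * internal_dist \<psi> \<Omega> z w"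
    using assms unfolding internal_Lipschitz_def by blast
  have "norm (F w - F z) \<le> (C * 2) * weight z * dist z w"
    if "z \<in> \<Omega>" "w \<in> cball z (bdist \<Omega> z / 2)" for z w
  proof -
    have "norm (F w - F z) \<le> C * internal_dist \<psi> \<Omega> z w"
      using C(2)[OF that(1), of w] subsetD[OF half_ball_subset[OF that(1)] that(2)]
      by (simp add: norm_minus_commute)
    also have "\<dots> \<le> C * (2 * weight z * dist z w)"
      using internal_dist_half_ball[OF that] C(1) by (intro mult_left_mono) auto
    finally show ?thesis by (simp add: mult.assoc)
  qed
  then show thesis using that[of "C * 2"] C(1) by simp
qed

text \<open>Near a point of the curve the derivative is bounded by almost the value of \<open>C * weight\<close> there,
  so the increment over a short piece is at most the integral of \<open>C * weight + 2\<epsilon>\<close> over the piece.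
  This bound is additive over adjacent pieces, so it extends to the whole curve.\<close>

lemma increment_le_arc_length_integral:
  fixes F :: "'a \<Rightarrow> 'b::real_normed_vector"
  assumes deriv: "\<And>z. z \<in> \<Omega> \<Longrightarrow> (F has_derivative F' z) (at z)"
    and bound: "\<And>z h. z \<in> \<Omega> \<Longrightarrow> norm (F' z h) \<le> C * weight z * norm h" and "0 \<le> C"
    and g: "rectifiable_path g" "path_image g \<subseteq> \<Omega>"
  shows "norm (F (pathfinish g) - F (pathstart g)) \<le> C * arc_length_integral g weight"
proof (rule field_le_epsilon)
  fix \<epsilon>' :: real assume "\<epsilon>' > 0"
  let ?M = "interval_measure (arc_length g)"
  define L where "L = arc_length g 1 - arc_length g 0"
  have L: "L \<ge> 0" using arc_length_mono[OF g(1), of 0 1] by (simp add: L_def)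
  define \<epsilon> where "\<epsilon> = \<epsilon>' / (2 * L + 1)"
  have \<epsilon>: "\<epsilon> > 0" using \<open>\<epsilon>' > 0\<close> L by (simp add: \<epsilon>_def)
  \<comment> \<open>One \<open>\<epsilon>\<close> makes up for replacing the bound on the derivative nearby by the bound at one point of
    the piece, the other for replacing the latter by the integrand.\<close>
  define \<phi> where "\<phi> z = C * weight z + 2 * \<epsilon>" for z
  have cont_\<phi>: "continuous_on \<Omega> \<phi>"
    unfolding \<phi>_def by (intro continuous_intros continuous_on_weight)
  have int: "set_integrable ?M A (\<lambda>t. \<phi> (g t))" if "A \<in> sets borel" "A \<subseteq> {0..1}" for A
    using that by (intro set_integrable_along_path g continuous_on_subset[OF cont_\<phi>])
  have int_const: "set_integrable ?M A (\<lambda>t. c)" if "A \<in> sets borel" "A \<subseteq> {0..1}" for A and c :: real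
    using set_integrable_along_path[OF g(1), of "\<lambda>_. c", OF _ that] by simp
  have cg: "continuous_on {0..1} g"
    using g by (simp add: rectifiable_path_def path_def)
  have in_\<Omega>: "g t \<in> \<Omega>" if "0 \<le> t" "t \<le> 1" for t
    using g that by (auto simp: path_image_def)
  define P where "P a b \<longleftrightarrow> (0 \<le> a \<and> a \<le> b \<and> b \<le> 1 \<longrightarrow>
    norm (F (g b) - F (g a)) \<le> (LINT t:{a<..b}|?M. \<phi> (g t)))" for a b
  have "P a b" if "0 \<le> a" "a \<le> b" "b \<le> 1" for a b
    using \<open>a \<le> b\<close>
  proof (induction a b rule: Bolzano)
    case (trans a b c)
    show ?case unfolding P_def
    proof safe
      assume *: "0 \<le> a" "c \<le> 1"
      have "norm (F (g c) - F (g a)) \<le> norm (F (g c) - F (g b)) + norm (F (g b) - F (g a))"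
        using norm_triangle_ineq[of "F (g c) - F (g b)" "F (g b) - F (g a)"] by simp
      also have "\<dots> \<le> (LINT t:{b<..c}|?M. \<phi> (g t)) + (LINT t:{a<..b}|?M. \<phi> (g t))"
        using trans * unfolding P_def by (intro add_mono) auto
      also have "\<dots> = (LINT t:{a<..b} \<union> {b<..c}|?M. \<phi> (g t))"
        using trans * by (subst set_integral_Un) (auto intro!: int)
      also have "{a<..b} \<union> {b<..c} = {a<..c}" using trans by auto
      finally show "norm (F (g c) - F (g a)) \<le> (LINT t:{a<..c}|?M. \<phi> (g t))" .
    qed
  next
    case (local x)
    then have x: "0 \<le> x" "x \<le> 1" using that by auto
    have gx: "g x \<in> \<Omega>" using in_\<Omega> x by blast
    have "isCont (\<lambda>z. C * weight z) (g x)"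
      using continuous_on_mult_left[OF continuous_on_weight] gx open_domain
      by (simp add: continuous_on_eq_continuous_at)
    then obtain d1 where d1: "d1 > 0" "\<And>z. dist z (g x) < d1 \<Longrightarrow> dist (C * weight z) (C * weight (g x)) < \<epsilon>"
      using \<epsilon> unfolding continuous_at_eps_delta by blast
    obtain d2 where d2: "d2 > 0" "ball (g x) d2 \<subseteq> \<Omega>"
      using open_domain gx by (meson openE)
    define r where "r = min d1 d2"
    have r: "r > 0" "ball (g x) r \<subseteq> \<Omega>" using d1 d2 by (auto simp: r_def)
    have near: "\<bar>C * weight z - C * weight (g x)\<bar> < \<epsilon>" if "z \<in> ball (g x) r" for z
      using d1(2)[of z] that by (simp add: r_def dist_real_def dist_commute)
    obtain \<delta> where \<delta>: "\<delta> > 0" "\<And>t. t \<in> {0..1} \<Longrightarrow> dist t x < \<delta> \<Longrightarrow> dist (g t) (g x) < r"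
      using cg r(1) x unfolding continuous_on_iff by (metis atLeastAtMost_iff)
    define m where "m = C * weight (g x) + \<epsilon>"
    have m: "m \<ge> 0" using \<open>0 \<le> C\<close> weight_nonneg \<epsilon> by (simp add: m_def add_nonneg_nonneg)
    have "P s t" if "s \<le> x" "x \<le> t" "t - s < \<delta>" for s t
      unfolding P_def
    proof safe
      assume *: "0 \<le> s" "s \<le> t" "t \<le> 1"
      have in_ball: "g y \<in> ball (g x) r" if "s \<le> y" "y \<le> t" for y
        using \<delta>(2)[of y] that * \<open>s \<le> x\<close> \<open>x \<le> t\<close> \<open>t - s < \<delta>\<close> by (simp add: dist_real_def dist_commute)
      have "norm (F (g t) - F (g s)) \<le> m * norm (g t - g s)"
      proof (rule differentiable_bound)
        show "convex (ball (g x) r)" by simp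
        show "(F has_derivative F' z) (at z within ball (g x) r)" if "z \<in> ball (g x) r" for z
          using deriv that r by (blast intro: has_derivative_at_withinI)
        show "onorm (F' z) \<le> m" if "z \<in> ball (g x) r" for z
        proof (rule onorm_le)
          fix h
          have "norm (F' z h) \<le> C * weight z * norm h" using bound that r by blast
          also have "\<dots> \<le> m * norm h"
            using near[OF that] by (intro mult_right_mono) (auto simp: m_def)
          finally show "norm (F' z h) \<le> m * norm h" .
        qed
      qed (use in_ball * in auto)
      also have "\<dots> \<le> m * (arc_length g t - arc_length g s)"
        using dist_le_arc_length_diff[OF g(1) *] m by (intro mult_left_mono) (auto simp: dist_norm norm_minus_commute)
      also have "\<dots> = (LINT y:{s<..t}|?M. m)"
        using emeasure_arc_length_Ioc[OF g(1) *(2)] measure_arc_length_Ioc[OF g(1) *(2)]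
        by (simp add: set_lebesgue_integral_def)
      also have "\<dots> \<le> (LINT y:{s<..t}|?M. \<phi> (g y))"
      proof (rule set_integral_mono)
        fix y assume "y \<in> {s<..t}"
        then show "m \<le> \<phi> (g y)" using near[OF in_ball[of y]] by (simp add: m_def \<phi>_def)
      qed (use * in \<open>auto intro!: int int_const\<close>)
      finally show "norm (F (g t) - F (g s)) \<le> (LINT y:{s<..t}|?M. \<phi> (g y))" .
    qed
    then show ?case using \<delta>(1) by blast
  qed
  then have "norm (F (g 1) - F (g 0)) \<le> (LINT t:{0<..1}|?M. \<phi> (g t))"
    by (simp add: P_def)
  also have "\<dots> \<le> (LINT t:{0..1}|?M. \<phi> (g t))"
    unfolding set_lebesgue_integral_def
  proof (rule integral_mono)
    fix t :: real
    show "indicator {0<..1} t *\<^sub>R \<phi> (g t) \<le> indicator {0..1} t *\<^sub>R \<phi> (g t)"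
      using \<open>0 \<le> C\<close> weight_nonneg \<epsilon> by (auto simp: indicator_def \<phi>_def)
  qed (use int[of "{0<..1}"] int[of "{0..1}"] in \<open>simp_all add: set_integrable_def subset_eq\<close>)
  also have "\<dots> = C * arc_length_integral g weight + 2 * \<epsilon> * measure ?M {0..1}"
  proof -
    have "set_integrable ?M {0..1} (\<lambda>t. C * weight (g t))"
      using set_integrable_along_path[OF g(1) continuous_on_subset[OF continuous_on_weight g(2)], of "{0..1}"]
      by (intro set_integrable_mult_right) auto
    then show ?thesis
      using int_const[of "{0..1}" "2 * \<epsilon>"] emeasure_arc_length_unit_finite[OF g(1)]
      unfolding \<phi>_def arc_length_integral_def
      by (subst set_integral_add) (auto simp: set_lebesgue_integral_def)
  qed
  also have "2 * \<epsilon> * measure ?M {0..1} \<le> \<epsilon>'"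
  proof -
    have "2 * \<epsilon> * measure ?M {0..1} \<le> 2 * \<epsilon> * L"
      using measure_arc_length_unit[OF g(1)] \<epsilon> by (intro mult_left_mono) (auto simp: L_def)
    also have "\<dots> \<le> \<epsilon> * (2 * L + 1)" using \<epsilon> by (simp add: algebra_simps)
    also have "\<dots> = \<epsilon>'" using L by (simp add: \<epsilon>_def)
    finally show ?thesis .
  qed
  finally show "norm (F (pathfinish g) - F (pathstart g)) \<le> C * arc_length_integral g weight + \<epsilon>'"
    by (simp add: pathfinish_def pathstart_def)
qed

lemma derivative_bound_imp_internal_Lipschitz:
  fixes F :: "'a \<Rightarrow> 'b::real_normed_vector"
  assumes deriv: "\<And>z. z \<in> \<Omega> \<Longrightarrow> (F has_derivative F' z) (at z)"
    and bound: "\<And>z h. z \<in> \<Omega> \<Longrightarrow> norm (F' z h) \<le> C * weight z * norm h" and "0 < C"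
  shows "F \<in> internal_Lipschitz \<psi> \<Omega>"
proof -
  have "norm (F z1 - F z2) \<le> C * internal_dist \<psi> \<Omega> z1 z2" if "z1 \<in> \<Omega>" "z2 \<in> \<Omega>" for z1 z2
  proof -
    have "norm (F z1 - F z2) / C \<le> internal_dist \<psi> \<Omega> z1 z2"
      using that
    proof (rule internal_dist_greatest)
      fix g assume "rectifiable_path g" "path_image g \<subseteq> \<Omega>" "pathstart g = z1" "pathfinish g = z2"
      then have "norm (F z1 - F z2) \<le> C * arc_length_integral g weight"
        using increment_le_arc_length_integral[OF deriv bound less_imp_le[OF \<open>0 < C\<close>]]
        by (metis norm_minus_commute)
      then show "norm (F z1 - F z2) / C \<le> arc_length_integral g weight"
        using \<open>0 < C\<close> by (simp add: field_simps)
    qed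
    then show ?thesis using \<open>0 < C\<close> by (simp add: field_simps)
  qed
  then show ?thesis using \<open>0 < C\<close> unfolding internal_Lipschitz_def by blast
qed

end

lemma internal_Lipschitz_dominated:
  assumes "F \<in> internal_Lipschitz \<psi> \<Omega>"
    and "\<And>z1 z2. norm (H z1 - H z2) \<le> norm (F z1 - F z2)"
  shows "H \<in> internal_Lipschitz \<psi> \<Omega>"
  using assms(1) order_trans[OF assms(2)] unfolding internal_Lipschitz_def by blast

lemma derivative_le_local_Lipschitz:
  fixes F :: "'a::real_normed_vector \<Rightarrow> 'b::real_normed_vector"
  assumes deriv: "(F has_derivative F') (at z)" and "0 < r"
    and lip: "\<And>w. w \<in> cball z r \<Longrightarrow> norm (F w - F z) \<le> M * dist z w"
  shows "norm (F' h) \<le> M * norm h"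
proof (cases "h = 0")
  case True
  then show ?thesis using has_derivative_linear[OF deriv] by (simp add: linear_0)
next
  case False
  have "norm (F' h) / norm h \<le> M"
  proof (rule field_le_epsilon)
    fix e :: real assume "e > 0"
    then obtain d where d: "d > 0"
      "\<And>y. norm (y - z) < d \<Longrightarrow> norm (F y - F z - F' (y - z)) \<le> e * norm (y - z)"
      using deriv unfolding has_derivative_at_alt by blast
    \<comment> \<open>a step along \<open>h\<close> short enough for both the difference quotient and the Lipschitz bound\<close>
    define t where "t = min d r / (2 * norm h)"
    have t: "t > 0" "t * norm h < d" "t * norm h \<le> r"
      using d(1) \<open>0 < r\<close> False by (auto simp: t_def)
    have "t * norm (F' h) = norm (F' (t *\<^sub>R h))"
      using t has_derivative_linear[OF deriv] by (simp add: linear_scale)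
    also have "\<dots> \<le> norm (F (z + t *\<^sub>R h) - F z) + norm (F (z + t *\<^sub>R h) - F z - F' (t *\<^sub>R h))"
      using norm_triangle_ineq4[of "F (z + t *\<^sub>R h) - F z" "F (z + t *\<^sub>R h) - F z - F' (t *\<^sub>R h)"] by simp
    also have "\<dots> \<le> M * (t * norm h) + e * (t * norm h)"
      using lip[of "z + t *\<^sub>R h"] d(2)[of "z + t *\<^sub>R h"] t
      by (intro add_mono) (auto simp: dist_norm)
    finally have "t * norm (F' h) \<le> t * ((M + e) * norm h)" by (simp add: algebra_simps)
    then have "norm (F' h) \<le> (M + e) * norm h" using t by simp
    then show "norm (F' h) / norm h \<le> M + e" using False by (simp add: field_simps)
  qed
  then show ?thesis using False by (simp add: field_simps)
qed

text \<open>At a zero of \<open>F\<close> the function and its norm have the same increments in norm; elsewhere the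
  derivative of the norm is the component of \<open>F' h\<close> in the direction of \<open>F z\<close>.\<close>

lemma norm_local_Lipschitz_derivative:
  fixes F :: "'a::real_normed_vector \<Rightarrow> 'b::real_inner"
  assumes deriv: "(F has_derivative F') (at z)" and "0 < r"
    and lip: "\<And>w. w \<in> cball z r \<Longrightarrow> \<bar>norm (F w) - norm (F z)\<bar> \<le> M * dist z w"
  shows "if F z = 0 then norm (F' h) \<le> M * norm h else \<bar>F' h \<bullet> sgn (F z)\<bar> \<le> M * norm h"
proof (cases "F z = 0")
  case True
  then show ?thesis
    using derivative_le_local_Lipschitz[OF deriv \<open>0 < r\<close>] lip by simp
next
  case False
  have "((\<lambda>w. norm (F w)) has_derivative (\<lambda>h. F' h \<bullet> sgn (F z))) (at z)"
    using has_derivative_compose[OF deriv has_derivative_norm[OF False]] by simp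
  from derivative_le_local_Lipschitz[OF this \<open>0 < r\<close>, of M h] show ?thesis
    using lip False by simp
qed

section \<open>The gradient of the real part of a holomorphic function\<close>

lemma has_vector_derivative_along_line:
  assumes "(u has_derivative u') (at (z + s *\<^sub>R a))"
  shows "((\<lambda>t. u (z + t *\<^sub>R a)) has_vector_derivative u' a) (at s)"
proof -
  have "((\<lambda>t. z + t *\<^sub>R a) has_derivative (\<lambda>h. h *\<^sub>R a)) (at s)"
    by (auto intro!: derivative_eq_intros)
  from has_derivative_compose[OF this assms] show ?thesis
    by (simp add: has_vector_derivative_def linear_scale[OF has_derivative_linear[OF assms]])
qed

lemma partial_eq_derivative:
  assumes "(u has_derivative u') (at z)"
  shows "partial_x j u z = u' (axis j 1)" "partial_y j u z = u' (axis j \<i>)"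
proof -
  have "((\<lambda>t. u (z + t *\<^sub>R a)) has_vector_derivative u' a) (at 0)" for a
    using assms by (intro has_vector_derivative_along_line) simp
  then show "partial_x j u z = u' (axis j 1)" "partial_y j u z = u' (axis j \<i>)"
    unfolding partial_x_def partial_y_def by (auto intro: vector_derivative_at)
qed

text \<open>Reading the pairs \<open>(u\<^sub>x, u\<^sub>y)\<close> as complex numbers turns the gradient into the vector that
  represents the derivative with respect to the real inner product.\<close>

lemma gradient_represents_derivative:
  fixes u :: "complex ^ 'n::finite \<Rightarrow> real"
  assumes "(u has_derivative u') (at z)"
  obtains \<gamma> where "norm \<gamma> = norm (gradient u z)" "\<And>h. u' h = h \<bullet> \<gamma>"
proof
  let ?\<gamma> = "\<chi> j. Complex (u' (axis j 1)) (u' (axis j \<i>))"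
  show "norm ?\<gamma> = norm (gradient u z)"
    by (simp add: norm_vec_def gradient_def partial_eq_derivative[OF assms] norm_Pair complex_norm)
  fix h :: "complex ^ 'n"
  have lin: "linear u'" using assms by (rule has_derivative_linear)
  have "h = (\<Sum>j\<in>UNIV. Re (h $ j) *\<^sub>R axis j 1 + Im (h $ j) *\<^sub>R axis j \<i>)"
    by (simp add: vec_eq_iff axis_def complex_eq_iff if_distrib[of "\<lambda>x. _ *\<^sub>R x"] if_distrib[of Re] if_distrib[of Im]
        cong: if_cong)
  then have "u' h = u' (\<Sum>j\<in>UNIV. Re (h $ j) *\<^sub>R axis j 1 + Im (h $ j) *\<^sub>R axis j \<i>)"
    by simp
  also have "\<dots> = (\<Sum>j\<in>UNIV. Re (h $ j) * u' (axis j 1) + Im (h $ j) * u' (axis j \<i>))"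
    by (simp add: linear_sum[OF lin] linear_add[OF lin] linear_scale[OF lin])
  also have "\<dots> = h \<bullet> ?\<gamma>"
    by (simp add: inner_vec_def inner_complex_def)
  finally show "u' h = h \<bullet> ?\<gamma>" .
qed

lemma derivative_le_gradient:
  fixes u :: "complex ^ 'n::finite \<Rightarrow> real"
  assumes "(u has_derivative u') (at z)"
  shows "\<bar>u' h\<bar> \<le> norm (gradient u z) * norm h"
proof -
  obtain \<gamma> where "norm \<gamma> = norm (gradient u z)" "u' h = h \<bullet> \<gamma>"
    using gradient_represents_derivative[OF assms] by metis
  then show ?thesis using Cauchy_Schwarz_ineq2[of h \<gamma>] by (simp add: mult.commute)
qed

lemma gradient_attained:
  fixes u :: "complex ^ 'n::finite \<Rightarrow> real"
  assumes "(u has_derivative u') (at z)"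
  obtains a where "norm a \<le> 1" "u' a = norm (gradient u z)"
proof -
  obtain \<gamma> where \<gamma>: "norm \<gamma> = norm (gradient u z)" "\<And>h. u' h = h \<bullet> \<gamma>"
    using gradient_represents_derivative[OF assms] by metis
  have "sgn \<gamma> \<bullet> \<gamma> = norm \<gamma>"
    by (cases "\<gamma> = 0") (simp_all add: sgn_div_norm dot_square_norm power2_eq_square)
  then show thesis using \<gamma> by (intro that[of "sgn \<gamma>"]) (auto simp: norm_sgn)
qed

lemma gradient_le_derivative_bound:
  fixes u :: "complex ^ 'n::finite \<Rightarrow> real"
  assumes "(u has_derivative u') (at z)" and le: "\<And>h. u' h \<le> M * norm h" and "0 \<le> M"
  shows "norm (gradient u z) \<le> M"
proof -
  obtain a where a: "norm a \<le> 1" "u' a = norm (gradient u z)"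
    using gradient_attained[OF assms(1)] .
  then have "norm (gradient u z) \<le> M * norm a" using le[of a] by simp
  also have "\<dots> \<le> M * 1" using a \<open>0 \<le> M\<close> by (intro mult_left_mono)
  finally show ?thesis by simp
qed

lemma continuous_on_norm_gradient:
  fixes u :: "complex ^ 'n::finite \<Rightarrow> real" and u' :: "complex ^ 'n \<Rightarrow> (complex ^ 'n) \<Rightarrow>\<^sub>L real"
  assumes deriv: "\<And>z. z \<in> S \<Longrightarrow> (u has_derivative blinfun_apply (u' z)) (at z)"
    and cont: "continuous_on S u'"
  shows "continuous_on S (\<lambda>z. norm (gradient u z))"
proof -
  have "continuous_on S (\<lambda>z. norm ((\<chi> j. (u' z (axis j 1), u' z (axis j \<i>))) :: (real \<times> real) ^ 'n))"
    by (intro continuous_intros cont)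
  then show ?thesis
    by (rule continuous_on_eq) (simp add: gradient_def partial_eq_derivative[OF deriv])
qed

lemma holomorphic_circle_mean:
  fixes f :: "complex ^ 'n::finite \<Rightarrow> complex"
  assumes hol: "several_holomorphic_on f \<Omega>"
    and disc: "\<And>c. norm c \<le> 1 \<Longrightarrow> w + c *s \<zeta> \<in> \<Omega>"
  shows "((\<lambda>t. f (w + exp (2 * of_real pi * \<i> * of_real t) *s \<zeta>)) has_integral f w) {0..1}"
proof -
  let ?e = "\<lambda>t::real. exp (2 * of_real pi * \<i> * of_real t)"
  define g where "g c = f (w + c *s \<zeta>)" for c
  have "g field_differentiable (at c)" if c: "c \<in> cball 0 1" for c
  proof -
    obtain f' where f': "(f has_derivative f') (at (w + c *s \<zeta>))" "\<And>k h. f' (k *s h) = k * f' h"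
      using hol disc c unfolding several_holomorphic_on_def by (metis mem_cball_0)
    have "linear (\<lambda>c. c *s \<zeta>)"
      by (rule linearI) (simp_all add: vec_eq_iff algebra_simps)
    then have "((\<lambda>c. w + c *s \<zeta>) has_derivative (\<lambda>c. c *s \<zeta>)) (at c)"
      by (auto intro!: derivative_eq_intros linear_imp_has_derivative)
    from has_derivative_compose[OF this f'(1)] have "(g has_derivative (\<lambda>k. k * f' \<zeta>)) (at c)"
      by (simp add: g_def[abs_def] f'(2))
    then have "(g has_field_derivative f' \<zeta>) (at c)"
      by (simp add: has_field_derivative_def mult.commute[of _ "f' \<zeta>"] mult_commute_abs)
    then show ?thesis using field_differentiable_def by blast
  qed
  then have "g holomorphic_on cball 0 1"
    unfolding holomorphic_on_def by (blast intro: field_differentiable_at_within)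
  then have "((\<lambda>c. g c / (c - 0)) has_contour_integral (2 * of_real pi * \<i> * g 0)) (circlepath 0 1)"
    by (intro Cauchy_integral_circlepath_simple) auto
  then have "((\<lambda>t. g (?e t) / ?e t * (2 * of_real pi * \<i> * ?e t)) has_integral (2 * of_real pi * \<i> * g 0)) {0..1}"
    unfolding has_contour_integral_def
    by (rule has_integral_eq[rotated]) (simp add: vector_derivative_circlepath01, simp add: circlepath)
  then have "((\<lambda>t. (2 * of_real pi * \<i>) * g (?e t)) has_integral (2 * of_real pi * \<i> * g 0)) {0..1}"
    by (simp add: mult.commute)
  then have "((\<lambda>t. (1 / (2 * of_real pi * \<i>)) * ((2 * of_real pi * \<i>) * g (?e t)))
      has_integral (1 / (2 * of_real pi * \<i>)) * (2 * of_real pi * \<i> * g 0)) {0..1}"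
    by (rule has_integral_mult_right)
  then show ?thesis by (simp add: g_def)
qed

text \<open>Differentiating the mean value property of \<open>u\<close> at \<open>w\<close> in a direction \<open>a\<close> gives the one of the
  directional derivative of \<open>u\<close>; choosing for \<open>a\<close> the direction of the gradient at \<open>w\<close> makes the left-hand
  side the length of the gradient.\<close>

lemma gradient_circle_submean:
  fixes f :: "complex ^ 'n::finite \<Rightarrow> complex" and u :: "complex ^ 'n \<Rightarrow> real"
    and u' :: "complex ^ 'n \<Rightarrow> (complex ^ 'n) \<Rightarrow>\<^sub>L real"
  assumes hol: "several_holomorphic_on f \<Omega>" and Re_f: "\<And>z. u z = Re (f z)"
    and deriv: "\<And>z. z \<in> \<Omega> \<Longrightarrow> (u has_derivative blinfun_apply (u' z)) (at z)"
    and cont: "continuous_on \<Omega> u'"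
    and ball: "ball w \<rho> \<subseteq> \<Omega>" and \<zeta>: "norm \<zeta> < \<rho>"
  shows "norm (gradient u w)
    \<le> integral {0..1} (\<lambda>t. norm (gradient u (w + exp (2 * of_real pi * \<i> * of_real t) *s \<zeta>)))"
proof -
  define e :: "real \<Rightarrow> complex" where "e t = exp (2 * of_real pi * \<i> * of_real t)" for t
  have norm_e: "norm (e t) = 1" for t by (simp add: e_def norm_exp_eq_Re)
  have cont_e: "continuous_on S e" for S unfolding e_def by (intro continuous_intros)
  have "0 < \<rho>" using \<zeta> norm_ge_zero[of \<zeta>] by linarith
  then have w: "w \<in> \<Omega>" using ball by auto
  obtain a where a: "norm a \<le> 1" "u' w a = norm (gradient u w)"
    using gradient_attained[OF deriv[OF w]] .
  \<comment> \<open>For \<open>s\<close> in \<open>U\<close>, the disc about \<open>w + s a\<close> in the direction \<open>\<zeta>\<close> still lies in the ball about \<open>w\<close>.\<close>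
  define U where "U = {- (\<rho> - norm \<zeta>)<..<\<rho> - norm \<zeta>}"
  have in_\<Omega>: "w + s *\<^sub>R a + c *s \<zeta> \<in> \<Omega>" if "s \<in> U" "norm c \<le> 1" for s c
  proof -
    have "norm (s *\<^sub>R a + c *s \<zeta>) \<le> \<bar>s\<bar> * norm a + norm c * norm \<zeta>"
      using norm_triangle_ineq[of "s *\<^sub>R a" "c *s \<zeta>"] by (simp add: norm_vec_scalar_mult)
    also have "\<dots> \<le> \<bar>s\<bar> * 1 + 1 * norm \<zeta>"
      using a that by (intro add_mono mult_mono) auto
    also have "\<dots> < \<rho>" using that by (auto simp: U_def)
    finally have "dist (w + (s *\<^sub>R a + c *s \<zeta>)) w < \<rho>"
      by (simp only: dist_norm add_diff_cancel_left')
    then have "w + (s *\<^sub>R a + c *s \<zeta>) \<in> ball w \<rho>"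
      by (simp only: mem_ball dist_commute[of w])
    then show ?thesis using subsetD[OF ball] by (simp only: add.assoc)
  qed
  have in_\<Omega>e: "w + s *\<^sub>R a + e t *s \<zeta> \<in> \<Omega>" if "s \<in> U" for s t
    using in_\<Omega>[OF that, of "e t"] by (simp add: norm_e)
  have U0: "0 \<in> U" using \<zeta> by (simp add: U_def)
  have in_\<Omega>0: "w + e t *s \<zeta> \<in> \<Omega>" for t using in_\<Omega>e[OF U0] by simp
  have mean: "((\<lambda>t. u (w + s *\<^sub>R a + e t *s \<zeta>)) has_integral u (w + s *\<^sub>R a)) {0..1}" if "s \<in> U" for s
  proof -
    have "((\<lambda>t. f (w + s *\<^sub>R a + e t *s \<zeta>)) has_integral f (w + s *\<^sub>R a)) {0..1}"
      unfolding e_def using in_\<Omega>[OF that] by (intro holomorphic_circle_mean[OF hol])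
    from has_integral_linear[OF this bounded_linear_Re] show ?thesis
      by (simp add: o_def Re_f)
  qed
  have right: "((\<lambda>s. integral (cbox 0 1) (\<lambda>t. u (w + s *\<^sub>R a + e t *s \<zeta>))) has_vector_derivative
      integral (cbox 0 1) (\<lambda>t. u' (w + 0 *\<^sub>R a + e t *s \<zeta>) a)) (at 0 within U)"
  proof (rule leibniz_rule_vector_derivative)
    fix s t :: real assume s: "s \<in> U"
    have "((\<lambda>s. u (w + e t *s \<zeta> + s *\<^sub>R a)) has_vector_derivative u' (w + e t *s \<zeta> + s *\<^sub>R a) a) (at s)"
      using deriv[OF in_\<Omega>e[OF s, of t]] by (intro has_vector_derivative_along_line) (simp add: ac_simps)
    then show "((\<lambda>s. u (w + s *\<^sub>R a + e t *s \<zeta>)) has_vector_derivative u' (w + s *\<^sub>R a + e t *s \<zeta>) a) (at s within U)"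
      by (simp add: ac_simps has_vector_derivative_at_within)
    show "(\<lambda>t. u (w + s *\<^sub>R a + e t *s \<zeta>)) integrable_on cbox 0 1"
      using mean[OF s] by (auto simp: integrable_on_def)
  next
    show "continuous_on (U \<times> cbox 0 1) (\<lambda>(s, t). u' (w + s *\<^sub>R a + e t *s \<zeta>) a)"
      unfolding split_beta'
      by (intro continuous_intros continuous_on_compose2[OF cont] continuous_on_compose2[OF cont_e[of UNIV]])
        (use in_\<Omega>e in auto)
  qed (use U0 in \<open>auto simp: U_def\<close>)
  have left: "((\<lambda>s. integral (cbox 0 1) (\<lambda>t. u (w + s *\<^sub>R a + e t *s \<zeta>))) has_vector_derivative
      u' w a) (at 0 within U)"
  proof (rule has_vector_derivative_transform[OF U0])
    show "integral (cbox 0 1) (\<lambda>t. u (w + s *\<^sub>R a + e t *s \<zeta>)) = u (w + s *\<^sub>R a)" if "s \<in> U" for s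
      using mean[OF that] by (simp add: integral_unique)
    show "((\<lambda>s. u (w + s *\<^sub>R a)) has_vector_derivative u' w a) (at 0 within U)"
      using deriv[OF w] by (intro has_vector_derivative_at_within[OF has_vector_derivative_along_line]) simp
  qed
  have at0: "at 0 within U = at (0::real)"
    using U0 by (intro at_within_open) (auto simp: U_def)
  have "norm (gradient u w) = integral {0..1} (\<lambda>t. u' (w + e t *s \<zeta>) a)"
    using vector_derivative_unique_at[OF left[unfolded at0] right[unfolded at0]] a(2) by simp
  also have "\<dots> \<le> integral {0..1} (\<lambda>t. norm (gradient u (w + e t *s \<zeta>)))"
  proof (rule integral_le)
    show "(\<lambda>t. u' (w + e t *s \<zeta>) a) integrable_on {0..1}"
      by (intro integrable_continuous_real continuous_intros continuous_on_compose2[OF cont] cont_e)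
        (use in_\<Omega>0 in auto)
    show "(\<lambda>t. norm (gradient u (w + e t *s \<zeta>))) integrable_on {0..1}"
      by (intro integrable_continuous_real continuous_intros cont_e
          continuous_on_compose2[OF continuous_on_norm_gradient[OF deriv cont]])
        (use in_\<Omega>0 in auto)
    fix t :: real
    have "u' (w + e t *s \<zeta>) a \<le> norm (gradient u (w + e t *s \<zeta>)) * norm a"
      using derivative_le_gradient[OF deriv[OF in_\<Omega>0], of t a] by simp
    also have "\<dots> \<le> norm (gradient u (w + e t *s \<zeta>)) * 1"
      using a(1) by (intro mult_left_mono) auto
    finally show "u' (w + e t *s \<zeta>) a \<le> norm (gradient u (w + e t *s \<zeta>))" by simp
  qed
  finally show ?thesis by (simp add: e_def)
qed

text \<open>The Cauchy-Riemann equations: the gradients of the real and the imaginary part of a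
  holomorphic function differ by a rotation in each coordinate.\<close>

lemma norm_gradient_Re_eq_Im:
  fixes f' :: "complex ^ 'n::finite \<Rightarrow> complex"
  assumes u: "(u has_derivative (\<lambda>h. Re (f' h))) (at z)" and v: "(v has_derivative (\<lambda>h. Im (f' h))) (at z)"
    and lin: "\<And>c h. f' (c *s h) = c * f' h"
  shows "norm (gradient u z) = norm (gradient v z)"
proof -
  have "f' (axis j \<i>) = \<i> * f' (axis j 1)" for j
  proof -
    have "axis j \<i> = \<i> *s (axis j 1 :: complex ^ 'n)"
      by (simp add: vec_eq_iff axis_def)
    then show ?thesis using lin[of \<i> "axis j 1"] by simp
  qed
  then show ?thesis
    by (simp add: norm_vec_def gradient_def partial_eq_derivative[OF u] partial_eq_derivative[OF v]
        norm_Pair add.commute)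
qed

section \<open>Gradient growth and Lipschitz conditions\<close>

lemma ball_lebesgue_integral_eq_lborel:
  fixes F :: "'a::euclidean_space \<Rightarrow> real"
  assumes "set_integrable lborel (ball z r) F"
  shows "set_lebesgue_integral lebesgue (ball z r) F = set_lebesgue_integral lborel (ball z r) F"
  unfolding set_lebesgue_integral_def
  using assms by (intro integral_completion) (auto simp: set_integrable_def)

locale gradient_domain = majorant_domain \<psi> \<Omega>
  for \<psi> and \<Omega> :: "(complex ^ 'n::finite) set" +
  fixes u :: "complex ^ 'n \<Rightarrow> real" and u' :: "complex ^ 'n \<Rightarrow> (complex ^ 'n) \<Rightarrow>\<^sub>L real"
  assumes deriv: "\<And>z. z \<in> \<Omega> \<Longrightarrow> (u has_derivative blinfun_apply (u' z)) (at z)"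
    and cont_deriv: "continuous_on \<Omega> u'"
begin

definition gradient_growth :: bool where
  "gradient_growth \<longleftrightarrow> (\<exists>C>0. \<forall>z\<in>\<Omega>. norm (gradient u z) \<le> C * weight z)"

lemma gradient_growthI:
  assumes "C > 0" "\<And>z h. z \<in> \<Omega> \<Longrightarrow> u' z h \<le> C * weight z * norm h"
  shows gradient_growth
  unfolding gradient_growth_def using assms weight_nonneg
  by (intro exI[of _ C] conjI ballI gradient_le_derivative_bound[OF deriv]) auto

lemma gradient_growth_imp_Lipschitz:
  assumes gradient_growth
  shows "u \<in> internal_Lipschitz \<psi> \<Omega>"
proof -
  obtain C where C: "C > 0" "\<And>z. z \<in> \<Omega> \<Longrightarrow> norm (gradient u z) \<le> C * weight z"
    using assms unfolding gradient_growth_def by blast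
  have "norm (u' z h) \<le> C * weight z * norm h" if "z \<in> \<Omega>" for z h
    using derivative_le_gradient[OF deriv[OF that], of h] mult_right_mono[OF C(2)[OF that] norm_ge_zero[of h]]
    by simp
  then show ?thesis using derivative_bound_imp_internal_Lipschitz[OF deriv] C(1) by blast
qed

lemma abs_Lipschitz_imp_gradient_growth:
  assumes "(\<lambda>z. \<bar>u z\<bar>) \<in> internal_Lipschitz \<psi> \<Omega>"
  shows gradient_growth
proof -
  obtain C where C: "C > 0"
    "\<And>z w. z \<in> \<Omega> \<Longrightarrow> w \<in> cball z (bdist \<Omega> z / 2) \<Longrightarrow> norm (\<bar>u w\<bar> - \<bar>u z\<bar>) \<le> C * weight z * dist z w"
    using internal_Lipschitz_half_ball[OF assms] by blast
  show ?thesis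
  proof (rule gradient_growthI[OF C(1)])
    fix z h assume z: "z \<in> \<Omega>"
    have "if u z = 0 then norm (u' z h) \<le> C * weight z * norm h
      else \<bar>u' z h \<bullet> sgn (u z)\<bar> \<le> C * weight z * norm h"
      by (rule norm_local_Lipschitz_derivative[OF deriv[OF z], where r = "bdist \<Omega> z / 2"])
        (use C(2)[OF z] bdist_pos[OF z] in auto)
    then have "\<bar>u' z h\<bar> \<le> C * weight z * norm h"
      by (auto simp: abs_mult abs_sgn_eq split: if_splits)
    then show "u' z h \<le> C * weight z * norm h" by linarith
  qed
qed

lemma gradient_growth_iff_Lipschitz: "gradient_growth \<longleftrightarrow> u \<in> internal_Lipschitz \<psi> \<Omega>"
  and gradient_growth_iff_abs_Lipschitz: "gradient_growth \<longleftrightarrow> (\<lambda>z. \<bar>u z\<bar>) \<in> internal_Lipschitz \<psi> \<Omega>"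
proof -
  have "(\<lambda>z. \<bar>u z\<bar>) \<in> internal_Lipschitz \<psi> \<Omega>" if "u \<in> internal_Lipschitz \<psi> \<Omega>"
    using that by (rule internal_Lipschitz_dominated) (simp add: abs_triangle_ineq3)
  then show "gradient_growth \<longleftrightarrow> u \<in> internal_Lipschitz \<psi> \<Omega>"
    "gradient_growth \<longleftrightarrow> (\<lambda>z. \<bar>u z\<bar>) \<in> internal_Lipschitz \<psi> \<Omega>"
    using gradient_growth_imp_Lipschitz abs_Lipschitz_imp_gradient_growth by blast+
qed

lemma set_integrable_gradient_power:
  assumes "z \<in> \<Omega>" "0 < p"
  shows "set_integrable lborel (ball z (bdist \<Omega> z / 2)) (\<lambda>w. norm (gradient u w) powr p)"
  using assms half_ball_subset[OF assms(1)]
  by (intro set_integrable_ball continuous_on_powr' continuous_on_const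
      continuous_on_subset[OF continuous_on_norm_gradient[OF deriv cont_deriv]]) auto

lemma gradient_mean_lborel:
  assumes "z \<in> \<Omega>" "0 < p"
  shows "gradient_mean \<Omega> u p z =
    ((LINT w:ball z (bdist \<Omega> z / 2)|lborel. norm (gradient u w) powr p)
      / measure lborel (ball z (bdist \<Omega> z / 2))) powr (1 / p)"
  unfolding gradient_mean_def
  by (subst ball_lebesgue_integral_eq_lborel[OF set_integrable_gradient_power[OF assms]])
    (simp add: measure_completion)

lemma gradient_growth_imp_mean_growth:
  assumes gradient_growth "0 < p"
  shows "\<exists>C>0. \<forall>z\<in>\<Omega>. gradient_mean \<Omega> u p z \<le> C * weight z"
proof -
  obtain C where C: "C > 0" "\<And>z. z \<in> \<Omega> \<Longrightarrow> norm (gradient u z) \<le> C * weight z"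
    using assms unfolding gradient_growth_def by blast
  have "gradient_mean \<Omega> u p z \<le> (2 * C) * weight z" if z: "z \<in> \<Omega>" for z
  proof -
    let ?B = "ball z (bdist \<Omega> z / 2)"
    define D where "D = 2 * C * weight z"
    have D: "D \<ge> 0" using C(1) weight_nonneg by (simp add: D_def)
    have le: "norm (gradient u w) \<le> D" if "w \<in> ?B" for w
    proof -
      have "w \<in> cball z (bdist \<Omega> z / 2)" using that by simp
      then have "norm (gradient u w) \<le> C * weight w" "C * weight w \<le> C * (2 * weight z)"
        using C half_ball_subset[OF z] weight_half_ball[OF z] by (auto simp: subset_eq)
      then show ?thesis by (simp add: D_def)
    qed
    have "(LINT w:?B|lborel. norm (gradient u w) powr p) \<le> (LINT w:?B|lborel. D powr p)"
      using le \<open>0 < p\<close>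
      by (intro set_integral_mono set_integrable_gradient_power z set_integrable_ball powr_mono2) auto
    also have "\<dots> = D powr p * measure lborel ?B"
      using emeasure_lborel_ball_finite[of z "bdist \<Omega> z / 2"] by (simp add: set_lebesgue_integral_def)
    finally have "(LINT w:?B|lborel. norm (gradient u w) powr p) / measure lborel ?B \<le> D powr p"
      using content_ball_pos[of "bdist \<Omega> z / 2" z] bdist_pos[OF z] by (simp add: field_simps)
    moreover have "0 \<le> (LINT w:?B|lborel. norm (gradient u w) powr p) / measure lborel ?B"
      unfolding set_lebesgue_integral_def by (intro divide_nonneg_nonneg integral_nonneg_AE AE_I2) auto
    ultimately have "gradient_mean \<Omega> u p z \<le> (D powr p) powr (1 / p)"
      unfolding gradient_mean_lborel[OF z \<open>0 < p\<close>] using \<open>0 < p\<close> by (intro powr_mono2) auto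
    also have "\<dots> = D" using D \<open>0 < p\<close> by (simp add: powr_powr)
    finally show ?thesis by (simp add: D_def)
  qed
  then show ?thesis using C(1) by (intro exI[of _ "2 * C"]) auto
qed

lemma mean_growth_imp_gradient_growth:
  assumes hol: "several_holomorphic_on f \<Omega>" and Re_f: "\<And>z. u z = Re (f z)"
    and mean: "\<exists>C>0. \<forall>z\<in>\<Omega>. gradient_mean \<Omega> u p z \<le> C * weight z" and "0 < p"
  shows gradient_growth
proof -
  obtain C where C: "C > 0" "\<And>z. z \<in> \<Omega> \<Longrightarrow> gradient_mean \<Omega> u p z \<le> C * weight z"
    using mean by blast
  define K where "K = 2 powr (p + DIM(complex ^ 'n) / p)"
  have "norm (gradient u z) \<le> (K powr (1 / p) * C) * weight z" if z: "z \<in> \<Omega>" for z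
  proof -
    define G where "G w = norm (gradient u w)" for w
    define R where "R = bdist \<Omega> z / 2"
    define J where "J = (LINT w:ball z R|lborel. G w powr p)"
    define m where "m = measure lborel (ball z R)"
    have R: "R > 0" using bdist_pos[OF z] by (simp add: R_def)
    have m: "m > 0" using content_ball_pos[of R z] R by (simp add: m_def)
    have cball: "cball z R \<subseteq> \<Omega>" using half_ball_subset[OF z] by (simp add: R_def)
    have cont_G: "continuous_on \<Omega> G"
      unfolding G_def using deriv cont_deriv by (rule continuous_on_norm_gradient)
    have "m * G z powr p \<le> K * J"
      unfolding m_def K_def J_def
    proof (rule submean_power)
      show "continuous_on (cball z R) G" using cont_G cball by (rule continuous_on_subset)
      fix w \<rho> assume \<rho>: "0 < \<rho>" "cball w \<rho> \<subseteq> cball z R"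
      show "measure lborel (ball w \<rho>) * G w \<le> (LINT x:ball w \<rho>|lborel. G x)"
      proof (rule circle_submean_imp_ball_submean)
        show "continuous_on (cball w \<rho>) G" using \<rho> cball by (intro continuous_on_subset[OF cont_G]) auto
        have "ball w \<rho> \<subseteq> \<Omega>" using \<rho>(2) cball ball_subset_cball by blast
        moreover fix \<zeta> :: "complex ^ 'n" assume "norm \<zeta> < \<rho>"
        ultimately show "G w \<le> integral {0..1} (\<lambda>t. G (w + exp (2 * of_real pi * \<i> * of_real t) *s \<zeta>))"
          unfolding G_def by (intro gradient_circle_submean[OF hol Re_f deriv cont_deriv])
      qed (simp add: G_def)
    qed (use R \<open>0 < p\<close> in \<open>simp_all add: G_def\<close>)
    then have "G z powr p \<le> K * (J / m)" using m by (simp add: field_simps)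
    then have "(G z powr p) powr (1 / p) \<le> (K * (J / m)) powr (1 / p)"
      using \<open>0 < p\<close> by (intro powr_mono2) auto
    also have "\<dots> = K powr (1 / p) * (J / m) powr (1 / p)"
      by (rule powr_mult)
    also have "(J / m) powr (1 / p) = gradient_mean \<Omega> u p z"
      unfolding gradient_mean_lborel[OF z \<open>0 < p\<close>] J_def m_def G_def R_def ..
    also have "K powr (1 / p) * \<dots> \<le> K powr (1 / p) * (C * weight z)"
      using C(2)[OF z] by (intro mult_left_mono) auto
    also have "(G z powr p) powr (1 / p) = G z"
      using \<open>0 < p\<close> by (simp add: powr_powr G_def)
    finally show ?thesis by (simp add: G_def)
  qed
  moreover have "K powr (1 / p) * C > 0" using C(1) by (simp add: K_def)
  ultimately show ?thesis unfolding gradient_growth_def by blast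
qed

text \<open>Multiplying \<open>h\<close> by a suitable unimodular scalar rotates \<open>f' h\<close>, by complex linearity, into the
  direction of \<open>f z\<close>, where \<open>|f|\<close> detects its full length.\<close>

lemma norm_Lipschitz_imp_gradient_growth:
  assumes hol: "several_holomorphic_on f \<Omega>" and Re_f: "\<And>z. u z = Re (f z)"
    and lip: "(\<lambda>z. norm (f z)) \<in> internal_Lipschitz \<psi> \<Omega>"
  shows gradient_growth
proof -
  obtain C where C: "C > 0"
    "\<And>z w. z \<in> \<Omega> \<Longrightarrow> w \<in> cball z (bdist \<Omega> z / 2) \<Longrightarrow>
      norm (norm (f w) - norm (f z)) \<le> C * weight z * dist z w"
    using internal_Lipschitz_half_ball[OF lip] by blast
  show ?thesis
  proof (rule gradient_growthI[OF C(1)])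
    fix z h assume z: "z \<in> \<Omega>"
    obtain f' where f': "(f has_derivative f') (at z)" and lin: "\<And>c h. f' (c *s h) = c * f' h"
      using hol z unfolding several_holomorphic_on_def by blast
    have local: "if f z = 0 then norm (f' k) \<le> C * weight z * norm k
      else \<bar>f' k \<bullet> sgn (f z)\<bar> \<le> C * weight z * norm k" for k
      by (rule norm_local_Lipschitz_derivative[OF f', where r = "bdist \<Omega> z / 2"])
        (use C(2)[OF z] bdist_pos[OF z] in auto)
    have M: "0 \<le> C * weight z" using C(1) weight_nonneg by simp
    have "norm (f' h) \<le> C * weight z * norm h"
    proof (cases "f z = 0")
      case True
      then show ?thesis using local[of h] by simp
    next
      case False
      \<comment> \<open>\<open>c\<close> has modulus 1 unless \<open>f' h = 0\<close>, when it vanishes.\<close>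
      define c where "c = sgn (f z) * cnj (sgn (f' h))"
      have "cnj (sgn (f' h)) * f' h = norm (f' h)"
        by (cases "f' h = 0") (simp_all add: sgn_eq complex_norm_square[symmetric] power2_eq_square mult.commute[of "cnj _"])
      then have "f' (c *s h) = norm (f' h) *\<^sub>R sgn (f z)"
        by (simp add: lin c_def mult.assoc scaleR_conv_of_real)
      then have "norm (f' h) = f' (c *s h) \<bullet> sgn (f z)"
        using False by (simp add: dot_square_norm norm_sgn)
      also have "\<dots> \<le> C * weight z * norm (c *s h)"
        using local[of "c *s h"] False by simp
      also have "\<dots> \<le> C * weight z * (1 * norm h)"
        unfolding norm_vec_scalar_mult c_def
        by (intro mult_left_mono mult_right_mono M) (auto simp: norm_mult norm_sgn)
      finally show ?thesis by simp
    qed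
    moreover have "u' z h = Re (f' h)"
    proof -
      have "(u has_derivative (\<lambda>h. Re (f' h))) (at z)"
        unfolding Re_f using f' by (rule bounded_linear.has_derivative[OF bounded_linear_Re])
      then have "blinfun_apply (u' z) = (\<lambda>h. Re (f' h))"
        using deriv[OF z] by (rule has_derivative_unique[rotated])
      then show ?thesis by simp
    qed
    ultimately show "u' z h \<le> C * weight z * norm h"
      using complex_Re_le_cmod[of "f' h"] by linarith
  qed
qed

end

lemma internal_Lipschitz_complex:
  assumes "u \<in> internal_Lipschitz \<psi> \<Omega>" "v \<in> internal_Lipschitz \<psi> \<Omega>"
  shows "(\<lambda>z. complex_of_real (u z) + \<i> * complex_of_real (v z)) \<in> internal_Lipschitz \<psi> \<Omega>"
proof -
  obtain C D where C: "C > 0" "\<And>z w. z \<in> \<Omega> \<Longrightarrow> w \<in> \<Omega> \<Longrightarrow> norm (u z - u w) \<le> C * internal_dist \<psi> \<Omega> z w"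
    and D: "D > 0" "\<And>z w. z \<in> \<Omega> \<Longrightarrow> w \<in> \<Omega> \<Longrightarrow> norm (v z - v w) \<le> D * internal_dist \<psi> \<Omega> z w"
    using assms unfolding internal_Lipschitz_def by blast
  have "norm ((complex_of_real (u z) + \<i> * complex_of_real (v z)) - (complex_of_real (u w) + \<i> * complex_of_real (v w)))
      \<le> (C + D) * internal_dist \<psi> \<Omega> z w" if "z \<in> \<Omega>" "w \<in> \<Omega>" for z w
  proof -
    have "norm ((complex_of_real (u z) + \<i> * complex_of_real (v z)) - (complex_of_real (u w) + \<i> * complex_of_real (v w)))
        \<le> \<bar>u z - u w\<bar> + \<bar>v z - v w\<bar>"
      using cmod_le[of "(complex_of_real (u z) + \<i> * complex_of_real (v z)) - (complex_of_real (u w) + \<i> * complex_of_real (v w))"]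
      by simp
    also have "\<dots> \<le> (C + D) * internal_dist \<psi> \<Omega> z w"
      using C(2)[OF that] D(2)[OF that] by (simp add: distrib_right)
    finally show ?thesis .
  qed
  then show ?thesis
    using C(1) D(1) unfolding internal_Lipschitz_def by (intro CollectI exI[of _ "C + D"]) auto
qed

lemma pluriharmonic_imp_continuous_derivative:
  fixes u :: "complex ^ 'n::finite \<Rightarrow> real"
  assumes "pluriharmonic_on u \<Omega>"
  obtains u' :: "complex ^ 'n \<Rightarrow> (complex ^ 'n) \<Rightarrow>\<^sub>L real"
  where "\<And>z. z \<in> \<Omega> \<Longrightarrow> (u has_derivative blinfun_apply (u' z)) (at z)" "continuous_on \<Omega> u'"
proof -
  obtain u' :: "complex ^ 'n \<Rightarrow> (complex ^ 'n) \<Rightarrow>\<^sub>L real"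
    and u'' :: "complex ^ 'n \<Rightarrow> (complex ^ 'n) \<Rightarrow>\<^sub>L ((complex ^ 'n) \<Rightarrow>\<^sub>L real)"
    where "\<forall>z\<in>\<Omega>. (u has_derivative blinfun_apply (u' z)) (at z)"
      and u'': "\<forall>z\<in>\<Omega>. (u' has_derivative blinfun_apply (u'' z)) (at z)"
    using assms unfolding pluriharmonic_on_def twice_continuously_differentiable_on_def by blast
  moreover have "continuous_on \<Omega> u'"
    using u'' by (meson continuous_at_imp_continuous_on has_derivative_continuous)
  ultimately show thesis using that by blast
qed

theorem theorem2p15:
  fixes \<psi> :: "real \<Rightarrow> real"
    and \<Omega> :: "(complex ^ 'n::finite) set"
    and u v :: "complex ^ 'n \<Rightarrow> real"
    and f :: "complex ^ 'n \<Rightarrow> complex"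
    and p q :: real
  assumes "fast_majorant \<psi>"
    and "open \<Omega>" and "connected \<Omega>" and "\<Omega> \<noteq> {}" and "bounded \<Omega>"
    and "pluriharmonic_on u \<Omega>" and "pluriharmonic_on v \<Omega>"
    and "f = (\<lambda>z. complex_of_real (u z) + \<i> * complex_of_real (v z))"
    and "several_holomorphic_on f \<Omega>"
    and "if CARD('n) \<ge> 2 then p \<ge> (2 * real CARD('n) - 2) / (2 * real CARD('n) - 1) else p > 0"
    and "if CARD('n) \<ge> 2 then q \<ge> (2 * real CARD('n) - 2) / (2 * real CARD('n) - 1) else q > 0"
  shows "all_equivalent
    [u \<in> internal_Lipschitz \<psi> \<Omega>,
     \<exists>C>0. \<forall>z\<in>\<Omega>. norm (gradient u z) \<le> C * (\<psi> (bdist \<Omega> z) / bdist \<Omega> z),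
     (\<lambda>z. \<bar>u z\<bar>) \<in> internal_Lipschitz \<psi> \<Omega>,
     \<exists>C>0. \<forall>z\<in>\<Omega>. gradient_mean \<Omega> u p z \<le> C * (\<psi> (bdist \<Omega> z) / bdist \<Omega> z),
     v \<in> internal_Lipschitz \<psi> \<Omega>,
     \<exists>C>0. \<forall>z\<in>\<Omega>. norm (gradient v z) \<le> C * (\<psi> (bdist \<Omega> z) / bdist \<Omega> z),
     (\<lambda>z. \<bar>v z\<bar>) \<in> internal_Lipschitz \<psi> \<Omega>,
     \<exists>C>0. \<forall>z\<in>\<Omega>. gradient_mean \<Omega> v q z \<le> C * (\<psi> (bdist \<Omega> z) / bdist \<Omega> z),
     f \<in> internal_Lipschitz \<psi> \<Omega>,
     (\<lambda>z. norm (f z)) \<in> internal_Lipschitz \<psi> \<Omega>]"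
proof -
  interpret majorant_domain \<psi> \<Omega>
    using assms by unfold_locales (simp_all add: fast_majorant_def)
  obtain u' v' :: "complex ^ 'n \<Rightarrow> (complex ^ 'n) \<Rightarrow>\<^sub>L real" where
    u': "\<And>z. z \<in> \<Omega> \<Longrightarrow> (u has_derivative blinfun_apply (u' z)) (at z)" "continuous_on \<Omega> u'" and
    v': "\<And>z. z \<in> \<Omega> \<Longrightarrow> (v has_derivative blinfun_apply (v' z)) (at z)" "continuous_on \<Omega> v'"
    using pluriharmonic_imp_continuous_derivative[OF assms(6)]
      pluriharmonic_imp_continuous_derivative[OF assms(7)] by metis
  interpret u: gradient_domain \<psi> \<Omega> u u' using u' by unfold_locales
  interpret v: gradient_domain \<psi> \<Omega> v v' using v' by unfold_locales
  have Re_f: "u z = Re (f z)" and Im_f: "v z = Im (f z)" for z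
    using assms(8) by simp_all
  have positive: "0 < (r::real)"
    if "if CARD('n) \<ge> 2 then r \<ge> (2 * real CARD('n) - 2) / (2 * real CARD('n) - 1) else r > 0" for r
  proof (cases "CARD('n) \<ge> 2")
    case True
    then have "0 < (2 * real CARD('n) - 2) / (2 * real CARD('n) - 1)" by (intro divide_pos_pos) auto
    also have "\<dots> \<le> r" using that True by simp
    finally show ?thesis .
  qed (use that in simp)
  have grad_eq: "norm (gradient v z) = norm (gradient u z)" if z: "z \<in> \<Omega>" for z
  proof -
    obtain f' where f': "(f has_derivative f') (at z)" "\<And>c h. f' (c *s h) = c * f' h"
      using assms(9) z unfolding several_holomorphic_on_def by blast
    have "(u has_derivative (\<lambda>h. Re (f' h))) (at z)" "(v has_derivative (\<lambda>h. Im (f' h))) (at z)"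
      unfolding Re_f Im_f using f'(1)
      by (auto intro: bounded_linear.has_derivative[OF bounded_linear_Re] bounded_linear.has_derivative[OF bounded_linear_Im])
    from norm_gradient_Re_eq_Im[OF this f'(2)] show ?thesis by simp
  qed
  then have growth_eq: "v.gradient_growth \<longleftrightarrow> u.gradient_growth"
    by (simp add: u.gradient_growth_def v.gradient_growth_def)
  have mean_eq: "gradient_mean \<Omega> v q z = gradient_mean \<Omega> u q z" if z: "z \<in> \<Omega>" for z
  proof -
    have "indicator (ball z (bdist \<Omega> z / 2)) w *\<^sub>R norm (gradient v w) powr q
        = indicator (ball z (bdist \<Omega> z / 2)) w *\<^sub>R norm (gradient u w) powr q" for w
      using grad_eq[of w] half_ball_subset[OF z] by (auto simp: indicator_def subset_eq)
    then show ?thesis by (simp only: gradient_mean_def set_lebesgue_integral_def)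
  qed
  have mean_iff: "u.gradient_growth \<longleftrightarrow> (\<exists>C>0. \<forall>z\<in>\<Omega>. gradient_mean \<Omega> u r z \<le> C * weight z)"
    if "0 < r" for r
    using u.gradient_growth_imp_mean_growth u.mean_growth_imp_gradient_growth[OF assms(9) Re_f] that by blast
  have "f \<in> internal_Lipschitz \<psi> \<Omega>" if "u.gradient_growth"
    using internal_Lipschitz_complex[of u \<psi> \<Omega> v] that growth_eq
    by (simp add: assms(8) u.gradient_growth_iff_Lipschitz v.gradient_growth_iff_Lipschitz)
  moreover have "(\<lambda>z. norm (f z)) \<in> internal_Lipschitz \<psi> \<Omega>" if "f \<in> internal_Lipschitz \<psi> \<Omega>"
    using that by (rule internal_Lipschitz_dominated) (simp add: norm_triangle_ineq3)
  ultimately have f_iff: "u.gradient_growth \<longleftrightarrow> f \<in> internal_Lipschitz \<psi> \<Omega>"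
    "u.gradient_growth \<longleftrightarrow> (\<lambda>z. norm (f z)) \<in> internal_Lipschitz \<psi> \<Omega>"
    using u.norm_Lipschitz_imp_gradient_growth[OF assms(9) Re_f] by blast+
  have "P \<longleftrightarrow> u.gradient_growth" if "P \<in> set
    [u \<in> internal_Lipschitz \<psi> \<Omega>,
     \<exists>C>0. \<forall>z\<in>\<Omega>. norm (gradient u z) \<le> C * weight z,
     (\<lambda>z. \<bar>u z\<bar>) \<in> internal_Lipschitz \<psi> \<Omega>,
     \<exists>C>0. \<forall>z\<in>\<Omega>. gradient_mean \<Omega> u p z \<le> C * weight z,
     v \<in> internal_Lipschitz \<psi> \<Omega>,
     \<exists>C>0. \<forall>z\<in>\<Omega>. norm (gradient v z) \<le> C * weight z,
     (\<lambda>z. \<bar>v z\<bar>) \<in> internal_Lipschitz \<psi> \<Omega>,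
     \<exists>C>0. \<forall>z\<in>\<Omega>. gradient_mean \<Omega> v q z \<le> C * weight z,
     f \<in> internal_Lipschitz \<psi> \<Omega>,
     (\<lambda>z. norm (f z)) \<in> internal_Lipschitz \<psi> \<Omega>]" for P
    using that
    unfolding list.set insert_iff
  proof (elim disjE emptyE)
    assume "P = (\<exists>C>0. \<forall>z\<in>\<Omega>. gradient_mean \<Omega> v q z \<le> C * weight z)"
    then show ?thesis using mean_iff[OF positive[OF assms(11)]] mean_eq by simp
  qed (simp_all only: f_iff[symmetric] growth_eq mean_iff[OF positive[OF assms(10)], symmetric]
      u.gradient_growth_iff_Lipschitz[symmetric] u.gradient_growth_iff_abs_Lipschitz[symmetric] u.gradient_growth_def[symmetric]
      v.gradient_growth_iff_Lipschitz[symmetric] v.gradient_growth_iff_abs_Lipschitz[symmetric] v.gradient_growth_def[symmetric])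
  then show ?thesis unfolding all_equivalent_def weight_def by blast
qed

end
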